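(* For each integer $n\ge 2$, let $\beta_n>1$ be the (unique) real root greater than $1$ of the polynomial $x^n-x-1$. Then, for $n\ge 2$, $\beta_n$ is a Parry number if and only if $n=2$ or $n=3$.
   Context: Fix a real number $\beta>1$. The beta transformation is $T_\beta:[0,1)\to[0,1)$, $T_\beta(x)=\beta x-\lfloor \beta x\rfloor$. Let $\mathcal A=\mathbb Z\cap[0,\beta)$. For $x\in[0,1)$ put $a_n=\lfloor \beta T_\beta^{n-1}(x)\rfloor$ ($n\ge 1$) and $d_\beta(x)=a_1a_2\dots\in\mathcal A^{\mathbb N}$. The expansion of one is the infinite word $d_\beta(1-0)=c_1c_2\dots\in\mathcal A^{\mathbb N}$ defined as the limit (in the product topology) of $d_\beta(1-\epsilon)$ as $\epsilon>0$ tends to $0$. Let $s$ be the shift $s((\xi_n))=(\xi_{n+1})$ and $\ll$ the (strict) lexicographic order on $\mathcal A^{\mathbb N}$. A word $\xi\in\mathcal A^{\mathbb N}$ is admissible if $s^n(\xi)\ll d_\beta(1-0)$ for all $n\ge 0$; a finite word $w$ over $\mathcal A$ is admissible if $w000\dots$ is admissible. The beta shift is $(X_\beta,s)$ where $X_\beta$ is the set of $(\xi_n)\in\mathcal A^{\mathbb Z}$ such that $\xi_n\xi_{n+1}\dots\xi_m$ is admissible for all $n<m$. The number $\beta$ is called a Parry number if $(X_\beta,s)$ is sofic; equivalently, if $d_\beta(1-0)$ is eventually periodic. *)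

theory Defs
  imports "HOL-Analysis.Analysis" "HOL-Library.Fun_Lexorder"
begin

definition beta_map :: "real \<Rightarrow> real \<Rightarrow> real" where
  "beta_map \<beta> x = \<beta> * x - of_int \<lfloor>\<beta> * x\<rfloor>"

definition beta_alphabet :: "real \<Rightarrow> int set" where
  "beta_alphabet \<beta> = {a. 0 \<le> a \<and> of_int a < \<beta>}"

text \<open>One-sided words are indexed from 0, so position \<open>n\<close> holds the digit
  usually written \<open>a\<close> with index \<open>n + 1\<close>. Only \<open>x\<close> in \<open>{0..<1}\<close> is meaningful.\<close>

definition beta_expansion :: "real \<Rightarrow> real \<Rightarrow> nat \<Rightarrow> int" where
  "beta_expansion \<beta> x n = \<lfloor>\<beta> * (beta_map \<beta> ^^ n) x\<rfloor>"

text \<open>The limit is taken in the library's product topology on \<^typ>\<open>nat \<Rightarrow> int\<close>,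
  with \<^typ>\<open>int\<close> discrete; for \<open>\<beta> > 1\<close> it exists and is unique, see
  \<open>tendsto_expansion_of_one\<close> below.\<close>

definition expansion_of_one :: "real \<Rightarrow> nat \<Rightarrow> int" where
  "expansion_of_one \<beta> =
     (THE c :: nat \<Rightarrow> int. ((\<lambda>\<epsilon>. beta_expansion \<beta> (1 - \<epsilon>)) \<longlongrightarrow> c) (at_right 0))"

definition shift :: "(nat \<Rightarrow> 'a) \<Rightarrow> nat \<Rightarrow> 'a" where
  "shift \<xi> = (\<lambda>k. \<xi> (Suc k))"

text \<open>\<^const>\<open>less_fun\<close> is the strict lexicographic order.\<close>

definition admissible :: "real \<Rightarrow> (nat \<Rightarrow> int) \<Rightarrow> bool" where
  "admissible \<beta> \<xi> \<longleftrightarrow>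
     range \<xi> \<subseteq> beta_alphabet \<beta> \<and>
     (\<forall>n. less_fun ((shift ^^ n) \<xi>) (expansion_of_one \<beta>))"

definition admissible_word :: "real \<Rightarrow> int list \<Rightarrow> bool" where
  "admissible_word \<beta> w \<longleftrightarrow> admissible \<beta> (\<lambda>k. if k < length w then w ! k else 0)"

definition beta_shift :: "real \<Rightarrow> (int \<Rightarrow> int) set" where
  "beta_shift \<beta> =
     {\<xi>. range \<xi> \<subseteq> beta_alphabet \<beta> \<and> (\<forall>n m. n < m \<longrightarrow> admissible_word \<beta> (map \<xi> [n..m]))}"

text \<open>A set of two-sided sequences is sofic if it is the set of label sequences of all
  bi-infinite walks in some finite labelled directed graph. The graph is given by its
  finite set of labelled edges (source, label, target); vertices are natural numbers,
  which loses no generality for a finite graph. The dynamics is always the shift.\<close>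

definition sofic :: "(int \<Rightarrow> 'a) set \<Rightarrow> bool" where
  "sofic X \<longleftrightarrow>
     (\<exists>E :: (nat \<times> 'a \<times> nat) set. finite E \<and>
        X = {\<xi>. \<exists>v :: int \<Rightarrow> nat. \<forall>i. (v i, \<xi> i, v (i + 1)) \<in> E})"

definition parry_number :: "real \<Rightarrow> bool" where
  "parry_number \<beta> \<longleftrightarrow> 1 < \<beta> \<and> sofic (beta_shift \<beta>)"

text \<open>For \<open>n \<ge> 2\<close> the description is justified by \<open>ex1_root\<close> below.\<close>

definition beta_root :: "nat \<Rightarrow> real" where
  "beta_root n = (THE x. 1 < x \<and> x ^ n - x - 1 = 0)"

lemma ex1_root:
  assumes "2 \<le> n"
  shows "\<exists>!x::real. 1 < x \<and> x ^ n - x - 1 = 0"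
proof -
  obtain m where n: "n = Suc m" and m: "m \<ge> 1"
    using assms by (cases n) auto
  have "(2::real) ^ 2 \<le> 2 ^ n"
    using assms by (intro power_increasing) auto
  then have "\<exists>x. 1 \<le> x \<and> x \<le> 2 \<and> x ^ n - x - 1 = (0::real)"
    by (intro IVT') (auto intro!: continuous_intros)
  then obtain x :: real where x: "1 \<le> x" "x ^ n - x - 1 = 0"
    by blast
  have "x \<noteq> 1" using x by auto
  with x have ex: "1 < x \<and> x ^ n - x - 1 = 0" by auto
  have uniq: False
    if "1 < y" "y ^ n - y - 1 = 0" "1 < z" "z ^ n - z - 1 = 0" "y < z" for y z :: real
  proof -
    have "y ^ m < z ^ m"
      using that m by (intro power_strict_mono) auto
    moreover have "1 < y ^ m"
      using that m by (intro one_less_power) auto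
    ultimately have "y * (y ^ m - 1) < z * (z ^ m - 1)"
      using that by (intro mult_strict_mono) auto
    then show False
      using that by (simp add: n algebra_simps)
  qed
  show ?thesis
    using ex by (rule ex1I) (metis ex uniq linorder_neqE)
qed

lemma floor_eventually_near_zero:
  fixes y b :: real
  assumes "0 < b"
  shows "\<forall>\<^sub>F \<epsilon> in at_right 0. \<lfloor>y - b * \<epsilon>\<rfloor> = \<lceil>y\<rceil> - 1"
proof -
  define d where "d = (y - of_int \<lceil>y\<rceil> + 1) / b"
  have "0 < d"
    unfolding d_def using assms ceiling_correct[of y] by (intro divide_pos_pos) auto
  have "\<lfloor>y - b * \<epsilon>\<rfloor> = \<lceil>y\<rceil> - 1" if "0 < \<epsilon>" "\<epsilon> < d" for \<epsilon>
  proof -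
    have "0 < b * \<epsilon>" "b * \<epsilon> < y - of_int \<lceil>y\<rceil> + 1"
      using that assms by (auto simp: d_def field_simps)
    then show ?thesis
      using le_of_int_ceiling[of y] by (intro floor_unique; simp; linarith)
  qed
  then show ?thesis
    using \<open>0 < d\<close> by (auto simp: eventually_at_right_field)
qed

lemma beta_map_iterate_near_one:
  assumes "1 < \<beta>"
  shows "\<exists>c. \<forall>\<^sub>F \<epsilon> in at_right 0. (beta_map \<beta> ^^ n) (1 - \<epsilon>) = c - \<beta> ^ n * \<epsilon>"
proof (induction n)
  case 0
  show ?case by auto
next
  case (Suc n)
  then obtain c where c: "\<forall>\<^sub>F \<epsilon> in at_right 0. (beta_map \<beta> ^^ n) (1 - \<epsilon>) = c - \<beta> ^ n * \<epsilon>"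
    by blast
  have "\<forall>\<^sub>F \<epsilon> in at_right 0. \<lfloor>\<beta> * (c - \<beta> ^ n * \<epsilon>)\<rfloor> = \<lceil>\<beta> * c\<rceil> - 1"
    using floor_eventually_near_zero[of "\<beta> ^ Suc n" "\<beta> * c"] assms
    by (simp add: right_diff_distrib mult.assoc)
  with c have "\<forall>\<^sub>F \<epsilon> in at_right 0.
      (beta_map \<beta> ^^ Suc n) (1 - \<epsilon>) = (\<beta> * c - of_int (\<lceil>\<beta> * c\<rceil> - 1)) - \<beta> ^ Suc n * \<epsilon>"
    by eventually_elim (simp add: beta_map_def right_diff_distrib)
  then show ?case by blast
qed

lemma tendsto_expansion_of_one:
  assumes "1 < \<beta>"
  shows "((\<lambda>\<epsilon>. beta_expansion \<beta> (1 - \<epsilon>)) \<longlongrightarrow> expansion_of_one \<beta>) (at_right 0)"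
proof -
  have "\<exists>a. \<forall>\<^sub>F \<epsilon> in at_right 0. beta_expansion \<beta> (1 - \<epsilon>) n = a" for n
  proof -
    obtain c where c: "\<forall>\<^sub>F \<epsilon> in at_right 0. (beta_map \<beta> ^^ n) (1 - \<epsilon>) = c - \<beta> ^ n * \<epsilon>"
      using beta_map_iterate_near_one[OF assms] by blast
    have "\<forall>\<^sub>F \<epsilon> in at_right 0. \<lfloor>\<beta> * (c - \<beta> ^ n * \<epsilon>)\<rfloor> = \<lceil>\<beta> * c\<rceil> - 1"
      using floor_eventually_near_zero[of "\<beta> ^ Suc n" "\<beta> * c"] assms
    by (simp add: right_diff_distrib mult.assoc)
    with c have "\<forall>\<^sub>F \<epsilon> in at_right 0. beta_expansion \<beta> (1 - \<epsilon>) n = \<lceil>\<beta> * c\<rceil> - 1"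
      by eventually_elim (simp add: beta_expansion_def)
    then show ?thesis by blast
  qed
  then obtain a where "\<forall>\<^sub>F \<epsilon> in at_right 0. beta_expansion \<beta> (1 - \<epsilon>) n = a n" for n
    by metis
  then have a: "limitin (product_topology (\<lambda>_. euclidean) UNIV)
      (\<lambda>\<epsilon>. beta_expansion \<beta> (1 - \<epsilon>)) a (at_right 0)"
    by (auto simp: limitin_componentwise tendsto_discrete)
  have uniq: "c = d" if "(f \<longlongrightarrow> c) (at_right (0::real))" "(f \<longlongrightarrow> d) (at_right 0)"
    for f :: "real \<Rightarrow> nat \<Rightarrow> int" and c d
  proof
    fix n
    have "((\<lambda>x. f x n) \<longlongrightarrow> c n) (at_right 0)" "((\<lambda>x. f x n) \<longlongrightarrow> d n) (at_right 0)"
      using that by (auto simp flip: limitin_canonical_iff euclidean_product_topology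
          simp: limitin_componentwise)
    then show "c n = d n"
      using tendsto_unique[OF trivial_limit_at_right_real] by blast
  qed
  from a have lim: "((\<lambda>\<epsilon>. beta_expansion \<beta> (1 - \<epsilon>)) \<longlongrightarrow> a) (at_right 0)"
    by (simp add: euclidean_product_topology)
  show ?thesis
    unfolding expansion_of_one_def
    by (rule theI[where P = "\<lambda>c. (_ \<longlongrightarrow> c) _", OF lim uniq[OF _ lim]])
qed

end

theory Submission
  imports Defs "HOL-Computational_Algebra.Polynomial_Factorial"
    "HOL-Computational_Algebra.Fundamental_Theorem_Algebra"
begin

text \<open>Let \<open>\<beta>\<close> be the real root \<open>> 1\<close> of \<open>x ^ n - x - 1\<close> and \<open>c\<close> the expansion of one. The digits
  of \<open>c\<close> are produced by the orbit \<open>y 0 = 1\<close>, \<open>y (k + 1) = \<beta> * y k - c k\<close>, which stays in \<open>{0<..1}\<close>.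

  For \<open>n = 2\<close> and \<open>n = 3\<close> this orbit is periodic, because \<open>\<beta> ^ p * (\<beta> - 1) = 1\<close> with \<open>p = 1\<close> and
  \<open>p = 4\<close> respectively; for \<open>n = 3\<close> the reason is the factorisation
  \<open>x ^ 5 - x ^ 4 - 1 = (x ^ 3 - x - 1) * (x\<^sup>2 - x + 1)\<close>. Then \<open>c\<close> repeats a one followed by \<open>p\<close>
  zeros, and the beta shift consists of the 0-1 sequences whose ones are separated by at least \<open>p\<close>
  zeros. A graph with \<open>p + 1\<close> vertices presents it (\<open>parry_number_if_simple_orbit\<close>).

  Let \<open>n \<ge> 4\<close> and suppose that the beta shift is sofic. Then \<open>c\<close> is eventually periodic
  (\<open>sofic_imp_eventually_periodic\<close>), so two orbit points coincide, and this is a polynomial relation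
  for \<open>\<beta>\<close> with integer coefficients. By Selmer's theorem \<open>x ^ n - x - 1\<close> is irreducible
  (\<open>irreducible_selmer_poly\<close>), so every complex root \<open>\<gamma>\<close> of it satisfies the same relation: the
  complex orbit \<open>z 0 = 1\<close>, \<open>z (k + 1) = \<gamma> * z k - c k\<close> takes only finitely many values. Since
  \<open>\<beta> - 1\<close> is small, every one in \<open>c\<close> is followed by at least \<open>p\<close> zeros as long as
  \<open>\<beta> ^ p * (\<beta> - 1) \<le> 1\<close>, and along such a block of zeros \<open>z\<close> is multiplied by \<open>\<gamma> ^ p\<close>. If
  \<open>\<bar>\<gamma>\<bar> > 1\<close>, then boundedness of \<open>z\<close> turns this into
  \<open>\<bar>\<gamma> - 1\<bar> * (\<bar>\<gamma>\<bar> ^ (p + 1) - 1) \<le> 1\<close> (\<open>conjugate_gap_bound\<close>).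

  The root \<open>\<gamma>\<close> whose argument lies just above \<open>2 * pi / n\<close> violates this inequality
  (\<open>trinomial_conjugate_beyond_gap\<close>). Heuristically \<open>\<beta> - 1\<close> is close to \<open>ln 2 / n\<close> and \<open>\<bar>\<gamma>\<bar>\<close> is close
  to \<open>\<beta>\<close>, so for the largest such \<open>p\<close> the second factor is close to \<open>n / ln 2\<close>, while
  \<open>\<bar>\<gamma> - 1\<bar>\<close> is close to \<open>2 * pi / n\<close>; the product is close to \<open>2 * pi / ln 2\<close>, which exceeds 9. The
  estimates below make this rigorous for \<open>n \<ge> 6\<close>; the degrees 4 and 5 are treated with explicit
  numerical bounds.\<close>

section \<open>The orbit of one\<close>

text \<open>The iterates of 1 under the left-continuous version of the beta map. The digit is
  \<open>\<lceil>\<beta> * y\<rceil> - 1\<close> instead of a floor because the points \<open>1 - \<epsilon>\<close> approach 1 from below: a product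
  \<open>\<beta> * y\<close> that is an integer is only ever approached, never reached.\<close>

primrec one_orbit :: "real \<Rightarrow> nat \<Rightarrow> real" where
  "one_orbit \<beta> 0 = 1"
| "one_orbit \<beta> (Suc k) = \<beta> * one_orbit \<beta> k - (of_int \<lceil>\<beta> * one_orbit \<beta> k\<rceil> - 1)"

lemma one_orbit_bounds:
  assumes "1 < \<beta>"
  shows "0 < one_orbit \<beta> k" "one_orbit \<beta> k \<le> 1"
proof -
  show "0 < one_orbit \<beta> k"
  proof (cases k)
    case (Suc j)
    then show ?thesis
      using ceiling_correct[of "\<beta> * one_orbit \<beta> j"] by simp
  qed auto
  show "one_orbit \<beta> k \<le> 1"
  proof (cases k)
    case (Suc j)
    then show ?thesis
      using ceiling_correct[of "\<beta> * one_orbit \<beta> j"] by simp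
  qed auto
qed

lemma beta_map_iterate_near_one_orbit:
  assumes "1 < \<beta>"
  shows "\<forall>\<^sub>F \<epsilon> in at_right 0. (beta_map \<beta> ^^ k) (1 - \<epsilon>) = one_orbit \<beta> k - \<beta> ^ k * \<epsilon>"
proof (induction k)
  case 0
  show ?case by simp
next
  case (Suc k)
  have "\<forall>\<^sub>F \<epsilon> in at_right 0.
      \<lfloor>\<beta> * one_orbit \<beta> k - \<beta> ^ Suc k * \<epsilon>\<rfloor> = \<lceil>\<beta> * one_orbit \<beta> k\<rceil> - 1"
    using assms by (intro floor_eventually_near_zero) auto
  with Suc.IH show ?case
    by eventually_elim (simp add: beta_map_def right_diff_distrib mult.assoc)
qed

lemma expansion_of_one_eq_ceiling:
  assumes "1 < \<beta>"
  shows "expansion_of_one \<beta> k = \<lceil>\<beta> * one_orbit \<beta> k\<rceil> - 1"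
proof -
  have "\<forall>\<^sub>F \<epsilon> in at_right 0.
      \<lfloor>\<beta> * one_orbit \<beta> k - \<beta> ^ Suc k * \<epsilon>\<rfloor> = \<lceil>\<beta> * one_orbit \<beta> k\<rceil> - 1"
    using assms by (intro floor_eventually_near_zero) auto
  with beta_map_iterate_near_one_orbit[OF assms, of k]
  have "\<forall>\<^sub>F \<epsilon> in at_right 0. beta_expansion \<beta> (1 - \<epsilon>) k = \<lceil>\<beta> * one_orbit \<beta> k\<rceil> - 1"
    by eventually_elim (simp add: beta_expansion_def right_diff_distrib mult.assoc)
  then have "((\<lambda>\<epsilon>. beta_expansion \<beta> (1 - \<epsilon>) k) \<longlongrightarrow> \<lceil>\<beta> * one_orbit \<beta> k\<rceil> - 1) (at_right 0)"
    by (rule tendsto_eventually)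
  moreover have "((\<lambda>\<epsilon>. beta_expansion \<beta> (1 - \<epsilon>) k) \<longlongrightarrow> expansion_of_one \<beta> k) (at_right 0)"
    using tendsto_expansion_of_one[OF assms]
    by (auto simp flip: limitin_canonical_iff euclidean_product_topology
        simp: limitin_componentwise)
  ultimately show ?thesis
    using tendsto_unique[OF trivial_limit_at_right_real] by blast
qed

lemma one_orbit_Suc:
  assumes "1 < \<beta>"
  shows "one_orbit \<beta> (Suc k) = \<beta> * one_orbit \<beta> k - of_int (expansion_of_one \<beta> k)"
  by (simp add: expansion_of_one_eq_ceiling[OF assms])

lemma expansion_of_one_nonneg:
  assumes "1 < \<beta>"
  shows "0 \<le> expansion_of_one \<beta> k"
proof -
  have "0 < \<beta> * one_orbit \<beta> k"
    using assms one_orbit_bounds[OF assms] by simp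
  then show ?thesis
    by (simp add: expansion_of_one_eq_ceiling[OF assms])
qed

lemma expansion_of_one_less:
  assumes "1 < \<beta>"
  shows "of_int (expansion_of_one \<beta> k) < \<beta>"
proof -
  have "of_int (expansion_of_one \<beta> k) < \<beta> * one_orbit \<beta> k"
    using ceiling_correct[of "\<beta> * one_orbit \<beta> k"]
    by (simp add: expansion_of_one_eq_ceiling[OF assms])
  also have "\<dots> \<le> \<beta> * 1"
    using assms one_orbit_bounds[OF assms] by (intro mult_left_mono) auto
  finally show ?thesis by simp
qed

lemma expansion_of_one_first_pos:
  assumes "1 < \<beta>"
  shows "0 < expansion_of_one \<beta> 0"
  using assms by (simp add: expansion_of_one_eq_ceiling[OF assms] less_ceiling_iff less_diff_eq)

lemma one_orbit_eq_zero_block: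
  assumes "1 < \<beta>" and "\<And>i. i < j \<Longrightarrow> expansion_of_one \<beta> (k + i) = 0"
  shows "one_orbit \<beta> (k + j) = \<beta> ^ j * one_orbit \<beta> k"
  using assms(2)
proof (induction j)
  case (Suc j)
  then show ?case
    by (simp add: one_orbit_Suc[OF assms(1)] del: one_orbit.simps)
qed simp

text \<open>Along a tail of zeros the orbit would grow like \<open>\<beta> ^ j\<close> and leave \<open>{0<..1}\<close>.\<close>

lemma expansion_of_one_nonzero_beyond:
  assumes "1 < \<beta>"
  shows "\<exists>j. expansion_of_one \<beta> (k + j) \<noteq> 0"
proof (rule ccontr)
  assume "\<nexists>j. expansion_of_one \<beta> (k + j) \<noteq> 0"
  then have eq: "one_orbit \<beta> (k + j) = \<beta> ^ j * one_orbit \<beta> k" for j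
    using one_orbit_eq_zero_block[OF assms] by blast
  obtain j where "1 / one_orbit \<beta> k < \<beta> ^ j"
    using real_arch_pow[OF assms] by blast
  then have "1 < one_orbit \<beta> (k + j)"
    unfolding eq using one_orbit_bounds(1)[OF assms, of k] by (simp add: field_simps)
  with one_orbit_bounds(2)[OF assms, of "k + j"] show False by simp
qed

text \<open>While the digits agree, the recursion multiplies the difference of two orbit points by
  \<open>\<beta>\<close>, so the larger point stays larger and cannot get the smaller digit first.\<close>

lemma one_orbit_diff:
  assumes "1 < \<beta>" and "\<And>i. i < j \<Longrightarrow> expansion_of_one \<beta> (a + i) = expansion_of_one \<beta> (b + i)"
  shows "one_orbit \<beta> (b + j) - one_orbit \<beta> (a + j) = \<beta> ^ j * (one_orbit \<beta> b - one_orbit \<beta> a)"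
  using assms(2)
proof (induction j)
  case (Suc j)
  have "one_orbit \<beta> (b + Suc j) - one_orbit \<beta> (a + Suc j) =
      \<beta> * (one_orbit \<beta> (b + j) - one_orbit \<beta> (a + j))"
    using Suc.prems by (simp add: one_orbit_Suc[OF assms(1)] right_diff_distrib del: one_orbit.simps)
  also have "one_orbit \<beta> (b + j) - one_orbit \<beta> (a + j) = \<beta> ^ j * (one_orbit \<beta> b - one_orbit \<beta> a)"
    using Suc by simp
  finally show ?case by simp
qed simp

text \<open>The orbit starts at its largest value 1, so no later point can generate a larger word.\<close>

lemma expansion_of_one_shift_not_greater:
  assumes "1 < \<beta>"
  shows "\<not> less_fun (expansion_of_one \<beta>) (\<lambda>i. expansion_of_one \<beta> (k + i))"
proof
  assume "less_fun (expansion_of_one \<beta>) (\<lambda>i. expansion_of_one \<beta> (k + i))"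
  then obtain j where j: "expansion_of_one \<beta> j < expansion_of_one \<beta> (k + j)"
    and eq: "\<And>i. i < j \<Longrightarrow> expansion_of_one \<beta> (k + i) = expansion_of_one \<beta> (0 + i)"
    by (auto elim!: less_funE)
  have "0 \<le> \<beta> ^ j * (one_orbit \<beta> 0 - one_orbit \<beta> k)"
    using assms one_orbit_bounds[OF assms] by simp
  then have "one_orbit \<beta> (k + j) \<le> one_orbit \<beta> j"
    using one_orbit_diff[of \<beta> j k 0] assms eq by simp
  then have "expansion_of_one \<beta> (k + j) \<le> expansion_of_one \<beta> j"
    unfolding expansion_of_one_eq_ceiling[OF assms]
    using assms by (intro diff_right_mono ceiling_mono mult_left_mono) auto
  with j show False by simp
qed

text \<open>Equal digit tails come from equal points: otherwise the difference would be multiplied by \<open>\<beta>\<close> at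
  every step, although both orbits stay in \<open>{0<..1}\<close>.\<close>

lemma one_orbit_periodic:
  assumes "1 < \<beta>" and "\<And>j. expansion_of_one \<beta> (M + j) = expansion_of_one \<beta> (N + j)"
  shows "one_orbit \<beta> M = one_orbit \<beta> N"
proof (rule ccontr)
  assume ne: "one_orbit \<beta> M \<noteq> one_orbit \<beta> N"
  define d where "d = \<bar>one_orbit \<beta> N - one_orbit \<beta> M\<bar>"
  have "d > 0" using ne by (simp add: d_def)
  obtain j where "1 / d < \<beta> ^ j"
    using real_arch_pow[OF assms(1)] by blast
  then have "1 < \<beta> ^ j * d" using \<open>d > 0\<close> by (simp add: field_simps)
  also have "\<dots> = \<bar>one_orbit \<beta> (N + j) - one_orbit \<beta> (M + j)\<bar>"
    using assms by (subst one_orbit_diff) (auto simp: d_def abs_mult)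
  finally show False
    using one_orbit_bounds[OF assms(1), of "N + j"] one_orbit_bounds[OF assms(1), of "M + j"] by linarith
qed

section \<open>Admissible sequences and soficity\<close>

lemma funpow_shift: "(shift ^^ n) \<xi> = (\<lambda>k. \<xi> (n + k))"
  by (induction n arbitrary: \<xi>) (auto simp: shift_def funpow_swap1
      simp del: funpow.simps(2) simp add: funpow_Suc_right)

text \<open>Admissibility of finite words involves words filled up with zeros. Cutting off a word that is at
  most the expansion of one makes it strictly smaller, because the expansion of one does not end
  in zeros. Hence the truncations disappear from the description of the beta shift below.\<close>

lemma less_fun_truncation:
  assumes "1 < \<beta>" and "\<not> less_fun (expansion_of_one \<beta>) \<eta>"
  shows "less_fun (\<lambda>k. if k < L then \<eta> k else 0) (expansion_of_one \<beta>)"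
proof -
  let ?c = "expansion_of_one \<beta>" and ?t = "\<lambda>k. if k < L then \<eta> k else 0"
  obtain j where "?c (L + j) \<noteq> 0"
    using expansion_of_one_nonzero_beyond[OF assms(1)] by blast
  then have ex: "\<exists>k. ?t k \<noteq> ?c k"
    by (intro exI[of _ "L + j"]) auto
  define k where "k = (LEAST k. ?t k \<noteq> ?c k)"
  have k: "?t k \<noteq> ?c k" and below: "\<And>i. i < k \<Longrightarrow> ?t i = ?c i"
    unfolding k_def using LeastI_ex[OF ex] not_less_Least by blast+
  have "\<not> ?c k < ?t k"
  proof
    assume gt: "?c k < ?t k"
    with expansion_of_one_nonneg[OF assms(1), of k] have "k < L"
      by (auto split: if_splits)
    moreover have "\<eta> i = ?c i" if "i < k" for i
      using below[OF that] that \<open>k < L\<close> by auto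
    ultimately have "less_fun ?c \<eta>"
      using gt by (intro less_funI exI[of _ k]) auto
    with assms(2) show False ..
  qed
  with k below show ?thesis
    by (intro less_funI exI[of _ k]) auto
qed

lemma beta_shift_iff:
  assumes "1 < \<beta>"
  shows "\<xi> \<in> beta_shift \<beta> \<longleftrightarrow> range \<xi> \<subseteq> beta_alphabet \<beta> \<and>
    (\<forall>i. \<not> less_fun (expansion_of_one \<beta>) (\<lambda>k. \<xi> (i + int k)))"
    (is "_ \<longleftrightarrow> ?R \<and> ?L")
proof (intro iffI conjI allI)
  assume \<xi>: "\<xi> \<in> beta_shift \<beta>"
  then show ?R by (simp add: beta_shift_def)
  fix i
  show "\<not> less_fun (expansion_of_one \<beta>) (\<lambda>k. \<xi> (i + int k))"
  proof
    assume "less_fun (expansion_of_one \<beta>) (\<lambda>k. \<xi> (i + int k))"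
    then obtain j where j: "expansion_of_one \<beta> j < \<xi> (i + int j)"
      and eq: "\<And>k. k < j \<Longrightarrow> expansion_of_one \<beta> k = \<xi> (i + int k)"
      by (auto elim!: less_funE)
    define w where "w = map \<xi> [i..i + int (Suc j)]"
    have w: "k < length w" "w ! k = \<xi> (i + int k)" if "k \<le> j" for k
      using that by (auto simp: w_def nth_upto)
    have "admissible_word \<beta> w"
      using \<xi> unfolding w_def beta_shift_def by simp
    then have "less_fun ((shift ^^ 0) (\<lambda>k. if k < length w then w ! k else 0)) (expansion_of_one \<beta>)"
      unfolding admissible_word_def admissible_def by blast
    moreover have "less_fun (expansion_of_one \<beta>) (\<lambda>k. if k < length w then w ! k else 0)"
      using j eq w by (intro less_funI exI[of _ j]) auto
    ultimately show False
      by (auto simp: funpow_shift dest: less_fun_asym)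
  qed
next
  assume RL: "?R \<and> ?L"
  have "admissible_word \<beta> (map \<xi> [n..m])" if "n < m" for n m
    unfolding admissible_word_def admissible_def
  proof (intro conjI allI)
    have "0 \<in> beta_alphabet \<beta>"
      using assms by (simp add: beta_alphabet_def)
    then show "range (\<lambda>k. if k < length (map \<xi> [n..m]) then map \<xi> [n..m] ! k else 0) \<subseteq> beta_alphabet \<beta>"
      using RL by (auto simp: nth_upto)
    fix p
    define L where "L = nat (m - n + 1)"
    have "(shift ^^ p) (\<lambda>k. if k < length (map \<xi> [n..m]) then map \<xi> [n..m] ! k else 0)
        = (\<lambda>k. if k < L - p then \<xi> ((n + int p) + int k) else 0)"
      by (auto simp: funpow_shift L_def nth_upto algebra_simps fun_eq_iff)
    then show "less_fun ((shift ^^ p) (\<lambda>k. if k < length (map \<xi> [n..m]) then map \<xi> [n..m] ! k else 0))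
        (expansion_of_one \<beta>)"
      using less_fun_truncation[OF assms, of "\<lambda>k. \<xi> ((n + int p) + int k)"] RL by simp
  qed
  with RL show "\<xi> \<in> beta_shift \<beta>"
    by (simp add: beta_shift_def)
qed

lemma expansion_of_one_padded_in_beta_shift:
  assumes "1 < \<beta>"
  shows "(\<lambda>i. if i < 0 then 0 else expansion_of_one \<beta> (nat i)) \<in> beta_shift \<beta>" (is "?\<xi> \<in> _")
  unfolding beta_shift_iff[OF assms]
proof (intro conjI allI)
  show "range ?\<xi> \<subseteq> beta_alphabet \<beta>"
    using assms by (auto simp: beta_alphabet_def expansion_of_one_nonneg expansion_of_one_less)
  fix i
  show "\<not> less_fun (expansion_of_one \<beta>) (\<lambda>k. ?\<xi> (i + int k))"
  proof (cases "i < 0")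
    case True
    show ?thesis
    proof
      assume "less_fun (expansion_of_one \<beta>) (\<lambda>k. ?\<xi> (i + int k))"
      then obtain j where j: "expansion_of_one \<beta> j < ?\<xi> (i + int j)"
        and eq: "\<And>k. k < j \<Longrightarrow> expansion_of_one \<beta> k = ?\<xi> (i + int k)"
        by (auto elim!: less_funE)
      show False
        using j eq[of 0] expansion_of_one_first_pos[OF assms] True
        by (cases "j = 0") (auto split: if_splits)
    qed
  next
    case False
    then have "(\<lambda>k. ?\<xi> (i + int k)) = (\<lambda>k. expansion_of_one \<beta> (nat i + k))"
      by (auto simp: fun_eq_iff nat_add_distrib)
    with expansion_of_one_shift_not_greater[OF assms] show ?thesis by simp
  qed
qed

text \<open>The walk that reads the expansion of one after a left-infinite string of zeros visits some vertex
  after two different prefixes of lengths \<open>M < N\<close>. At this vertex the futures can be interchanged, so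
  either prefix may be followed by the tail belonging to the other one. A spliced sequence cannot
  exceed the expansion of one; hence neither tail exceeds the other, and they are equal.\<close>

lemma sofic_imp_eventually_periodic:
  assumes "1 < \<beta>" and "sofic (beta_shift \<beta>)"
  shows "\<exists>M N. M < N \<and> (\<forall>j. expansion_of_one \<beta> (M + j) = expansion_of_one \<beta> (N + j))"
proof -
  let ?c = "expansion_of_one \<beta>"
  define \<xi> :: "int \<Rightarrow> int" where "\<xi> = (\<lambda>i. if i < 0 then 0 else ?c (nat i))"
  obtain E :: "(nat \<times> int \<times> nat) set" where "finite E"
    and E: "beta_shift \<beta> = {\<xi>. \<exists>v :: int \<Rightarrow> nat. \<forall>i. (v i, \<xi> i, v (i + 1)) \<in> E}"
    using assms(2) unfolding sofic_def by blast
  have "\<xi> \<in> beta_shift \<beta>"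
    unfolding \<xi>_def by (rule expansion_of_one_padded_in_beta_shift[OF assms(1)])
  then obtain v where v: "\<And>i. (v i, \<xi> i, v (i + 1)) \<in> E"
    unfolding E by blast
  have "range (\<lambda>k. v (int k)) \<subseteq> fst ` E"
    using v by force
  then have "finite (range (\<lambda>k. v (int k)))"
    using \<open>finite E\<close> finite_surj by blast
  then have "\<not> inj (\<lambda>k. v (int k))"
    using finite_imageD infinite_UNIV_nat by blast
  then obtain M N where MN: "M < N" "v (int M) = v (int N)"
    unfolding inj_def by (metis linorder_neqE_nat)
  have splice: "\<not> less_fun (\<lambda>j. ?c (a + j)) (\<lambda>j. ?c (b + j))"
    if "v (int a) = v (int b)" for a b
  proof
    assume "less_fun (\<lambda>j. ?c (a + j)) (\<lambda>j. ?c (b + j))"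
    then obtain j where j: "?c (a + j) < ?c (b + j)"
      and eq: "\<And>k. k < j \<Longrightarrow> ?c (a + k) = ?c (b + k)"
      by (auto elim!: less_funE)
    define \<xi>' where "\<xi>' = (\<lambda>i. if i < int a then \<xi> i else \<xi> (i - int a + int b))"
    define v' where "v' = (\<lambda>i. if i < int a then v i else v (i - int a + int b))"
    have "(v' i, \<xi>' i, v' (i + 1)) \<in> E" for i
    proof (cases "i + 1 = int a")
      case True
      then have "i < int a" "\<not> i + 1 < int a" by auto
      then show ?thesis
        using v[of i] that True by (simp add: v'_def \<xi>'_def)
    next
      case False
      then show ?thesis
        using v[of i] v[of "i - int a + int b"] by (auto simp: v'_def \<xi>'_def algebra_simps)
    qed
    then have "\<xi>' \<in> beta_shift \<beta>"
      unfolding E by blast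
    then have "\<not> less_fun ?c (\<lambda>k. \<xi>' (0 + int k))"
      unfolding beta_shift_iff[OF assms(1)] by blast
    moreover have "\<xi>' (int k) = (if k < a then ?c k else ?c (b + (k - a)))" for k
      by (auto simp: \<xi>'_def \<xi>_def nat_diff_distrib nat_add_distrib algebra_simps
          intro!: arg_cong[where f = ?c])
    moreover have "?c k = ?c (b + (k - a))" if "a \<le> k" "k < a + j" for k
      using eq[of "k - a"] that by auto
    ultimately show False
      using j unfolding less_fun_def by (auto dest!: spec[of _ "a + j"] split: if_splits)
  qed
  have "?c (M + j) = ?c (N + j)" for j
  proof (rule ccontr)
    assume ex: "?c (M + j) \<noteq> ?c (N + j)"
    define k where "k = (LEAST k. ?c (M + k) \<noteq> ?c (N + k))"
    have k: "?c (M + k) \<noteq> ?c (N + k)" and below: "\<And>i. i < k \<Longrightarrow> ?c (M + i) = ?c (N + i)"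
      unfolding k_def using LeastI[of "\<lambda>k. ?c (M + k) \<noteq> ?c (N + k)", OF ex] not_less_Least by blast+
    then have "less_fun (\<lambda>j. ?c (M + j)) (\<lambda>j. ?c (N + j)) \<or> less_fun (\<lambda>j. ?c (N + j)) (\<lambda>j. ?c (M + j))"
      unfolding less_fun_def by (metis linorder_neqE)
    with splice MN(2) show False by metis
  qed
  with MN(1) show ?thesis by blast
qed

section \<open>Shifts with separated ones\<close>

text \<open>For the periodic expansion of one that repeats a one followed by \<open>p\<close> zeros, the beta shift is
  this set of sequences.\<close>

definition sparse :: "nat \<Rightarrow> (int \<Rightarrow> int) \<Rightarrow> bool" where
  "sparse p \<xi> \<longleftrightarrow> range \<xi> \<subseteq> {0, 1} \<and>
     (\<forall>i j. \<xi> i = 1 \<longrightarrow> i < j \<longrightarrow> j \<le> i + int p \<longrightarrow> \<xi> j = 0)"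

text \<open>If two ones are too close, then the sequence exceeds \<open>c\<close> at the second one, counted from the first.
  Conversely, where a sequence first exceeds \<open>c\<close>, it has a one inside a block of zeros of \<open>c\<close>, and the
  one that opens this block in \<open>c\<close> also occurs in the sequence, at distance at most \<open>p\<close>.\<close>

lemma beta_shift_eq_sparse:
  assumes "1 < \<beta>" "\<beta> \<le> 2"
    and c: "\<And>k. expansion_of_one \<beta> k = (if k mod Suc p = 0 then 1 else 0)"
  shows "beta_shift \<beta> = {\<xi>. sparse p \<xi>}"
proof -
  have A: "beta_alphabet \<beta> = {0, 1}"
  proof -
    have "a < 2" if "of_int a < \<beta>" for a
      using that assms(2) by linarith
    then show ?thesis
      using assms(1) unfolding beta_alphabet_def by force
  qed
  show ?thesis
  proof (intro Set.set_eqI)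
    fix \<xi>
    have "(\<forall>i. \<not> less_fun (expansion_of_one \<beta>) (\<lambda>k. \<xi> (i + int k))) \<longleftrightarrow>
        (\<forall>i j. \<xi> i = 1 \<longrightarrow> i < j \<longrightarrow> j \<le> i + int p \<longrightarrow> \<xi> j = 0)" (is "?L \<longleftrightarrow> ?S")
      if R: "range \<xi> \<subseteq> {0, 1}"
    proof
      assume L: ?L
      have pos: "\<xi> (i + int j) = 0" if "\<xi> i = 1" "0 < j" "j \<le> p" for i j
        using that(2,3)
      proof (induction j rule: less_induct)
        case (less j)
        show ?case
        proof (rule ccontr)
          assume "\<xi> (i + int j) \<noteq> 0"
          then have "0 < \<xi> (i + int j)"
            using R by force
          moreover have "\<xi> (i + int k) = expansion_of_one \<beta> k" if "k < j" for k
            using that less \<open>\<xi> i = 1\<close> by (cases "k = 0") (auto simp: c)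
          ultimately have "less_fun (expansion_of_one \<beta>) (\<lambda>k. \<xi> (i + int k))"
            using less.prems by (intro less_funI exI[of _ j]) (auto simp: c)
          with L show False by blast
        qed
      qed
      show ?S
      proof (intro allI impI)
        fix i j assume "\<xi> i = 1" "i < j" "j \<le> i + int p"
        then show "\<xi> j = 0" using pos[of i "nat (j - i)"] by simp
      qed
    next
      assume S: ?S
      show ?L
      proof (intro allI notI)
        fix i
        assume "less_fun (expansion_of_one \<beta>) (\<lambda>k. \<xi> (i + int k))"
        then obtain j where j: "expansion_of_one \<beta> j < \<xi> (i + int j)"
          and eq: "\<And>k. k < j \<Longrightarrow> expansion_of_one \<beta> k = \<xi> (i + int k)"
          by (auto elim!: less_funE)
        have "\<xi> (i + int j) \<in> {0, 1}" using R by blast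
        with j have one: "\<xi> (i + int j) = 1" "j mod Suc p \<noteq> 0"
          by (auto simp: c split: if_splits)
        define k where "k = Suc p * (j div Suc p)"
        have k: "j = k + j mod Suc p" "k mod Suc p = 0" "j mod Suc p < Suc p"
          by (simp_all add: k_def del: mult_Suc)
        then have "k < j" using one by linarith
        then have "\<xi> (i + int k) = 1"
          using eq[of k] k by (simp add: c)
        moreover have "i + int j \<le> i + int k + int p"
          using k by linarith
        ultimately have "\<xi> (i + int j) = 0"
          using S \<open>k < j\<close> by (metis add_less_cancel_left of_nat_less_iff)
        with one show False by simp
      qed
    qed
    then show "\<xi> \<in> beta_shift \<beta> \<longleftrightarrow> \<xi> \<in> {\<xi>. sparse p \<xi>}"
      unfolding beta_shift_iff[OF assms(1)] A sparse_def mem_Collect_eq by blast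
  qed
qed

text \<open>The vertices of the graph are \<open>0, \<dots>, p\<close>, and the vertex \<open>k\<close> records that \<open>k\<close> zeros have to be
  read before the next one is allowed.\<close>

lemma sofic_sparse: "sofic {\<xi>. sparse p \<xi>}"
proof -
  define E :: "(nat \<times> int \<times> nat) set"
    where "E = insert (0, 0, 0) (insert (0, 1, p) ((\<lambda>k. (Suc k, 0, k)) ` {..<p}))"
  have "sparse p \<xi> \<longleftrightarrow> (\<exists>v. \<forall>i. (v i, \<xi> i, v (i + 1)) \<in> E)" for \<xi>
  proof
    assume S: "sparse p \<xi>"
    \<comment> \<open>The number of zeros still owed at time \<open>i\<close>: if the last one was read \<open>d \<le> p\<close> steps ago,
      then \<open>p + 1 - d\<close>, and otherwise 0. The set under the maximum has at most two elements.\<close>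
    define v where "v = (\<lambda>i. Max (insert 0 {Suc p - d | d. 0 < d \<and> d \<le> p \<and> \<xi> (i - int d) = 1}))"
    have R: "\<xi> i = 0 \<or> \<xi> i = 1" for i
      using S unfolding sparse_def by blast
    have gap: "\<xi> j = 0" if "\<xi> i = 1" "i < j" "j \<le> i + int p" for i j
      using S that unfolding sparse_def by blast
    have v_eq: "v i = Suc p - d" if "0 < d" "d \<le> p" "\<xi> (i - int d) = 1" for i d
    proof -
      have "d' = d" if "0 < d'" "d' \<le> p" "\<xi> (i - int d') = 1" for d'
        using gap[of "i - int d" "i - int d'"] gap[of "i - int d'" "i - int d"] that
          \<open>0 < d\<close> \<open>d \<le> p\<close> \<open>\<xi> (i - int d) = 1\<close>
        by (cases d d' rule: linorder_cases) auto
      then have "{Suc p - d | d. 0 < d \<and> d \<le> p \<and> \<xi> (i - int d) = 1} = {Suc p - d}"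
        using that by blast
      then show ?thesis by (simp add: v_def)
    qed
    have v_0: "v i = 0" if "\<And>d. 0 < d \<Longrightarrow> d \<le> p \<Longrightarrow> \<xi> (i - int d) \<noteq> 1" for i
    proof -
      have "{Suc p - d | d. 0 < d \<and> d \<le> p \<and> \<xi> (i - int d) = 1} = {}"
        using that by blast
      then show ?thesis by (simp only: v_def) simp
    qed
    have "(v i, \<xi> i, v (i + 1)) \<in> E" for i
    proof (cases "\<exists>d. 0 < d \<and> d \<le> p \<and> \<xi> (i - int d) = 1")
      case True
      then obtain d where d: "0 < d" "d \<le> p" "\<xi> (i - int d) = 1" by blast
      then have "\<xi> i = 0" using gap[of "i - int d" i] by simp
      have "v (i + 1) = p - d"
      proof (cases "d = p")
        case True
        have "\<xi> (i + 1 - int e) \<noteq> 1" if "0 < e" "e \<le> p" for e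
          using gap[of "i - int p" "i + 1 - int e"] d that True by auto
        with True show ?thesis by (simp add: v_0)
      next
        case False
        with d show ?thesis using v_eq[of "Suc d" "i + 1"] by simp
      qed
      moreover have "v i = Suc (p - d)"
        using v_eq[OF d] d by simp
      ultimately show ?thesis
        using d \<open>\<xi> i = 0\<close> by (auto simp: E_def)
    next
      case False
      then have "v i = 0" by (intro v_0) blast
      show ?thesis
      proof (cases "\<xi> i = 1")
        case True
        have "v (i + 1) = p"
        proof (cases "p = 0")
          case True
          then show ?thesis by (simp add: v_0)
        next
          case False
          then show ?thesis using v_eq[of 1 "i + 1"] True by simp
        qed
        with True \<open>v i = 0\<close> show ?thesis by (simp add: E_def)
      next
        case ne: False
        have "\<xi> (i + 1 - int d) \<noteq> 1" if "0 < d" "d \<le> p" for d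
          using False[simplified, rule_format, of "d - 1"] that ne by (cases "d = 1") (auto simp: of_nat_diff algebra_simps)
        then have "v (i + 1) = 0" by (rule v_0)
        with ne R[of i] \<open>v i = 0\<close> show ?thesis by (auto simp: E_def)
      qed
    qed
    then show "\<exists>v. \<forall>i. (v i, \<xi> i, v (i + 1)) \<in> E" by blast
  next
    assume "\<exists>v. \<forall>i. (v i, \<xi> i, v (i + 1)) \<in> E"
    then obtain v where v: "\<And>i. (v i, \<xi> i, v (i + 1)) \<in> E" by blast
    have R: "\<xi> i \<in> {0, 1}" for i
      using v[of i] by (auto simp: E_def)
    have zero: "\<xi> i = 0 \<and> v (i + 1) = k" if "v i = Suc k" for i k
      using v[of i] that by (auto simp: E_def)
    have "v (i + int d) = p + 1 - d" if "\<xi> i = 1" "0 < d" "d \<le> p" for i d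
      using that(2,3)
    proof (induction d)
      case (Suc d)
      show ?case
      proof (cases "d = 0")
        case True
        have "v (i + 1) = p"
          using v[of i] that(1) unfolding E_def by fastforce
        with True show ?thesis by simp
      next
        case False
        then have "v (i + int d) = Suc (p - d)" using Suc by auto
        then show ?thesis using zero[of "i + int d" "p - d"] Suc.prems by (simp add: algebra_simps)
      qed
    qed simp
    then have pos: "\<xi> (i + int d) = 0" if "\<xi> i = 1" "0 < d" "d \<le> p" for i d
      using that zero[of "i + int d" "p - d"] by (simp add: Suc_diff_le)
    have "\<xi> j = 0" if "\<xi> i = 1" "i < j" "j \<le> i + int p" for i j
      using pos[of i "nat (j - i)"] that by simp
    then show "sparse p \<xi>"
      unfolding sparse_def using R by blast
  qed
  moreover have "finite E" by (simp add: E_def)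
  ultimately show ?thesis
    unfolding sofic_def by blast
qed

text \<open>The equation says that the orbit of one returns to 1 after \<open>p + 1\<close> steps.\<close>

lemma parry_number_if_simple_orbit:
  assumes "1 < \<beta>" and "\<beta> \<le> 2" and root: "\<beta> ^ p * (\<beta> - 1) = 1"
  shows "parry_number \<beta>"
proof -
  let ?c = "expansion_of_one \<beta>" and ?y = "one_orbit \<beta>"
  have digit: "?c k = 0" if "\<beta> * ?y k \<le> 1" for k
  proof -
    have "0 < \<beta> * ?y k" using assms(1) one_orbit_bounds[OF assms(1)] by simp
    with that have "\<lceil>\<beta> * ?y k\<rceil> = 1" by (simp add: ceiling_eq_iff)
    then show ?thesis by (simp add: expansion_of_one_eq_ceiling[OF assms(1)])
  qed
  have one: "?c k = 1 \<and> ?y (Suc k) = \<beta> - 1" if "?y k = 1" for k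
  proof -
    have "\<lceil>\<beta>\<rceil> = 2" using assms by (simp add: ceiling_eq_iff)
    with that show ?thesis by (simp add: expansion_of_one_eq_ceiling[OF assms(1)])
  qed
  have block: "?y (k + Suc i) = \<beta> ^ i * (\<beta> - 1)" if "?y k = 1" "i \<le> p" for k i
    using that(2)
  proof (induction i)
    case 0
    then show ?case using one[OF that(1)] by simp
  next
    case (Suc i)
    then have y: "?y (k + Suc i) = \<beta> ^ i * (\<beta> - 1)" by simp
    have "\<beta> ^ Suc i * (\<beta> - 1) \<le> \<beta> ^ p * (\<beta> - 1)"
      using Suc.prems assms(1) by (intro mult_right_mono power_increasing) auto
    then have "\<beta> * ?y (k + Suc i) \<le> 1"
      using root y by simp
    then have "?y (Suc (k + Suc i)) = \<beta> * ?y (k + Suc i)"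
      by (simp add: one_orbit_Suc[OF assms(1)] digit del: one_orbit.simps)
    with y show ?case by simp
  qed
  have return: "?y (Suc p * q) = 1" for q
  proof (induction q)
    case (Suc q)
    show ?case
      using block[OF Suc, of p] root by (simp add: add_ac)
  qed simp
  have "?c k = (if k mod Suc p = 0 then 1 else 0)" for k
  proof -
    define q where "q = k div Suc p"
    define i where "i = k mod Suc p"
    have k: "k = Suc p * q + i"
      by (simp add: q_def i_def del: mult_Suc)
    have "i < Suc p" unfolding i_def by (rule mod_less_divisor) simp
    then have "i \<le> p" by simp
    show ?thesis
    proof (cases i)
      case 0
      with k have "?y k = 1" using return[of q] by (simp only: add_0_right)
      with 0 one[of k] show ?thesis by (simp add: i_def)
    next
      case (Suc j)
      have "?y (Suc p * q + Suc j) = \<beta> ^ j * (\<beta> - 1)"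
        using Suc \<open>i \<le> p\<close> by (intro block return) simp
      then have "?y k = \<beta> ^ j * (\<beta> - 1)"
        using k Suc by (simp only:)
      then have "\<beta> * ?y k = \<beta> ^ i * (\<beta> - 1)"
        using Suc by simp
      also have "\<dots> \<le> \<beta> ^ p * (\<beta> - 1)"
        using \<open>i \<le> p\<close> assms(1) by (intro mult_right_mono power_increasing) auto
      finally have "?c k = 0"
        using root by (intro digit) simp
      with Suc show ?thesis by (simp add: i_def)
    qed
  qed
  then have "beta_shift \<beta> = {\<xi>. sparse p \<xi>}"
    by (rule beta_shift_eq_sparse[OF assms(1,2)])
  with assms(1) show ?thesis
    by (simp add: parry_number_def sofic_sparse)
qed

section \<open>Irreducibility of trinomials\<close>

lemma of_int_poly_diff:
  "map_poly of_int (P - Q) = (map_poly of_int P - map_poly of_int Q :: 'a :: {comm_ring_1, ring_char_0} poly)"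
  by (rule poly_eqI) (simp add: coeff_map_poly)

lemma of_int_poly_mult:
  "map_poly of_int (P * Q) = (map_poly of_int P * map_poly of_int Q :: 'a :: {comm_ring_1, ring_char_0} poly)"
  by (rule poly_eqI) (simp add: coeff_map_poly coeff_mult)

lemma of_int_poly_smult:
  "map_poly of_int (smult a P) = (smult (of_int a) (map_poly of_int P) :: 'a :: {comm_ring_1, ring_char_0} poly)"
  by (rule poly_eqI) (simp add: coeff_map_poly)

text \<open>A nonzero integer polynomial \<open>D\<close> of least degree vanishing at \<open>\<alpha>\<close> divides, by pseudo-division, a
  nonzero integer multiple of every integer polynomial vanishing at \<open>\<alpha>\<close>. Applied to \<open>f\<close>, which is a
  prime element, this shows that \<open>f\<close> divides \<open>D\<close> or the cofactor; the latter would make \<open>D\<close> constant.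
  So \<open>D\<close> vanishes at \<open>\<gamma>\<close>, and hence so does \<open>P\<close>.\<close>

lemma irreducible_common_root_transfer:
  fixes f P :: "int poly" and \<alpha> :: "'a :: {idom, ring_char_0}" and \<gamma> :: "'b :: {idom, ring_char_0}"
  assumes f: "irreducible f" "poly (map_poly of_int f) \<alpha> = 0" "poly (map_poly of_int f) \<gamma> = 0"
    and P: "poly (map_poly of_int P) \<alpha> = 0"
  shows "poly (map_poly of_int P) \<gamma> = 0"
proof -
  let ?V = "\<lambda>D :: int poly. D \<noteq> 0 \<and> poly (map_poly of_int D) \<alpha> = 0"
  have "?V f" using f by auto
  then obtain D where D: "?V D" and min: "\<And>R. ?V R \<Longrightarrow> degree D \<le> degree R"
    using ex_has_least_nat[of ?V f degree] by blast
  have divides: "\<exists>a q. a \<noteq> 0 \<and> smult a Q = D * q" if "poly (map_poly of_int Q) \<alpha> = 0" for Q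
  proof -
    define R where "R = pseudo_mod Q D"
    obtain a q where aq: "a \<noteq> 0" "smult a Q = D * q + R" and R: "R = 0 \<or> degree R < degree D"
      using pseudo_mod[of D Q] D unfolding R_def by blast
    have "R = smult a Q - D * q" using aq by simp
    then have "map_poly of_int R = (smult (of_int a) (map_poly of_int Q) - map_poly of_int D * map_poly of_int q :: 'a poly)"
      by (simp add: poly_eq_iff coeff_map_poly flip: of_int_poly_mult of_int_poly_smult)
    then have "poly (map_poly of_int R) \<alpha> = 0"
      using that D by simp
    with min[of R] R have "R = 0" by fastforce
    with aq show ?thesis by auto
  qed
  have prime: "prime_elem f" using f(1) by (rule irreducible_imp_prime_poly)
  obtain a q where aq: "a \<noteq> 0" "smult a f = D * q" using divides f(2) by blast
  have "f dvd D * q" unfolding aq(2)[symmetric] by (simp add: dvd_smult)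
  then have "f dvd D \<or> f dvd q" using prime by (simp add: prime_elem_dvd_mult_iff)
  moreover have False if "f dvd q"
  proof -
    obtain q' where q': "q = f * q'" using \<open>f dvd q\<close> by (elim dvdE)
    then have "f * [:a:] = f * (D * q')" using aq by (simp add: mult_ac)
    then have "[:a:] = D * q'" using \<open>?V f\<close> by (metis mult_cancel_left)
    moreover have "q' \<noteq> 0" using calculation aq by auto
    ultimately have "degree D = 0"
      using D degree_mult_eq[of D q'] by (metis add_is_0 degree_pCons_0)
    then obtain d where "D = [:d:]" by (meson degree_eq_zeroE)
    with D show False by (simp add: map_poly_pCons)
  qed
  ultimately obtain D' where D': "D = f * D'" by (auto elim: dvdE)
  obtain a q where aq: "a \<noteq> 0" "smult a P = D * q" using divides P by blast
  have "poly (map_poly of_int (smult a P)) \<gamma> = 0"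
    unfolding aq(2) D' using f(3) by (simp add: of_int_poly_mult)
  with aq(1) show ?thesis by (simp add: of_int_poly_smult)
qed

text \<open>Vieta's formulas for the second highest and the two lowest coefficients. Writing \<open>pCons 0 p\<close> shifts
  the indices by one, so that the second highest coefficient of \<open>p\<close> needs no separate case when
  \<open>p\<close> is constant.\<close>

lemma coeffs_prod_linear:
  fixes M :: "'a :: field multiset"
  defines "p \<equiv> (\<Prod>x\<in>#M. [:- x, 1:])"
  shows "coeff (pCons 0 p) (size M) = - sum_mset M"
    "coeff p 0 = (\<Prod>x\<in>#M. - x)"
    "0 \<notin># M \<Longrightarrow> coeff p 1 = - coeff p 0 * (\<Sum>x\<in>#M. inverse x)"
proof -
  have "coeff p (size M) = 1 \<and> coeff (pCons 0 p) (size M) = - sum_mset M \<and> degree p = size M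
     \<and> coeff p 0 = (\<Prod>x\<in>#M. - x) \<and> (0 \<notin># M \<longrightarrow> coeff p 1 = - coeff p 0 * (\<Sum>x\<in>#M. inverse x))"
    unfolding p_def
  proof (induction M)
    case (add x M)
    let ?q = "\<Prod>x\<in>#M. [:- x, 1:]"
    have "?q \<noteq> 0" using add by force
    moreover from this have "degree ([:- x, 1:] * ?q) = Suc (size M)"
      using add degree_mult_eq[of "[:- x, 1:]" ?q] by simp
    ultimately show ?case
      using add by (auto simp: coeff_pCons field_simps coeff_eq_0 split: nat.splits)
  qed auto
  then show "coeff (pCons 0 p) (size M) = - sum_mset M"
    "coeff p 0 = (\<Prod>x\<in>#M. - x)"
    "0 \<notin># M \<Longrightarrow> coeff p 1 = - coeff p 0 * (\<Sum>x\<in>#M. inverse x)"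
    by auto
qed

text \<open>Selmer's functional. It is additive on products and, by Vieta, an integer for integer polynomials
  whose leading and constant coefficients are units.\<close>

definition root_sum :: "complex poly \<Rightarrow> complex" where
  "root_sum p = (\<Sum>x\<in>#proots p. x - inverse x)"

lemma root_sum_coeffs:
  assumes "poly p 0 \<noteq> 0"
  shows "root_sum p = coeff p 1 / coeff p 0 - coeff (pCons 0 p) (degree p) / lead_coeff p"
proof -
  let ?M = "proots p"
  let ?q = "\<Prod>x\<in>#?M. [:- x, 1:]"
  have "p \<noteq> 0" using assms by auto
  then have lc: "lead_coeff p \<noteq> 0" by simp
  have zero: "0 \<notin># ?M" using assms \<open>p \<noteq> 0\<close> by simp
  have p: "p = smult (lead_coeff p) ?q"
    by (rule complex_poly_decompose_multiset[symmetric])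
  have "coeff p 1 / coeff p 0 = coeff ?q 1 / coeff ?q 0"
    using lc by (subst (1 2) p) simp
  also have "\<dots> = - (\<Sum>x\<in>#?M. inverse x)"
    using coeffs_prod_linear(3)[OF zero] coeffs_prod_linear(2)[of ?M] zero by auto
  finally have 1: "coeff p 1 / coeff p 0 = - (\<Sum>x\<in>#?M. inverse x)" .
  have "coeff (pCons 0 p) (degree p) / lead_coeff p = coeff (pCons 0 ?q) (degree p)"
  proof -
    have "pCons 0 p = smult (lead_coeff p) (pCons 0 ?q)"
      by (subst p) simp
    then have "coeff (pCons 0 p) (degree p) = lead_coeff p * coeff (pCons 0 ?q) (degree p)"
      by (metis coeff_smult)
    then show ?thesis using lc by simp
  qed
  also have "\<dots> = - sum_mset ?M"
    using coeffs_prod_linear(1)[of ?M] by (simp add: size_proots_complex)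
  finally have 2: "coeff (pCons 0 p) (degree p) / lead_coeff p = - sum_mset ?M" .
  have split: "(\<Sum>x\<in>#N. x - inverse x) = sum_mset N - (\<Sum>x\<in>#N. inverse x)" for N :: "complex multiset"
    by (induction N) auto
  show ?thesis
    unfolding 1 2 using split[of ?M] by (simp add: root_sum_def)
qed

text \<open>If \<open>x\<close> and \<open>x + 1 = x ^ n\<close> both have modulus 1, then \<open>x\<close> is a primitive cube root of unity. Then
  \<open>x ^ n\<close> is a cube root of unity too, whereas \<open>x + 1 = - x\<^sup>2\<close> is not.\<close>

lemma trinomial_root_not_on_unit_circle:
  fixes x :: complex
  assumes "x ^ n = x + 1"
  shows "cmod x \<noteq> 1"
proof
  assume r: "cmod x = 1"
  have "cmod (x + 1) = 1"
    using assms r by (metis norm_power power_one)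
  then have "(cmod (x + 1))\<^sup>2 = 1" "(cmod x)\<^sup>2 = 1" using r by auto
  then have "Re x = - 1 / 2" and "(Re x)\<^sup>2 + (Im x)\<^sup>2 = 1"
    unfolding cmod_power2 by (simp_all add: power2_eq_square algebra_simps)
  then have "x\<^sup>2 + x + 1 = 0"
    by (simp add: complex_eq_iff power2_eq_square algebra_simps)
  then have "x + 1 = - x\<^sup>2" "x ^ 3 = 1"
    by algebra+
  then have "(x ^ n) ^ 3 = 1"
    by (metis power_mult power_one mult.commute)
  moreover have "(x ^ n) ^ 3 = - ((x ^ 3)\<^sup>2)"
    unfolding assms \<open>x + 1 = - x\<^sup>2\<close> by algebra
  ultimately show False
    using \<open>x ^ 3 = 1\<close> by simp
qed

text \<open>With \<open>s = \<bar>x\<bar>\<^sup>2\<close> the equation \<open>x ^ n = x + 1\<close> determines \<open>2 * Re x = s ^ n - s - 1\<close>, and then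
  \<open>Re (x - inverse x)\<close> exceeds \<open>(1 / s - 1) / 2\<close> by \<open>(s - 1) * (s ^ n - s) / (2 * s) > 0\<close>. The logarithmic
  form of the bound is chosen since logarithms of moduli add up to 0 over the roots of a factor.\<close>

lemma root_term_greater:
  fixes x :: complex
  assumes "x ^ n = x + 1" "2 \<le> n"
  shows "- ln (cmod x) < Re (x - inverse x)"
proof -
  define s where "s = (cmod x)\<^sup>2"
  have "x \<noteq> 0" using assms by (auto simp: power_0_left)
  then have "0 < s" by (simp add: s_def)
  have "s \<noteq> 1"
    using trinomial_root_not_on_unit_circle[OF assms(1)] norm_ge_zero[of x]
    unfolding s_def power2_eq_1_iff by linarith
  have "s ^ n = (cmod (x + 1))\<^sup>2"
    unfolding s_def assms(1)[symmetric] norm_power by (simp add: mult.commute flip: power_mult)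
  also have "\<dots> = s + 2 * Re x + 1"
    unfolding s_def cmod_power2 by (simp add: power2_eq_square algebra_simps)
  finally have Re_x: "Re x = (s ^ n - s - 1) / 2" by simp
  have "0 < (s - 1) * (s ^ n - s)"
  proof (cases "1 < s")
    case True
    then have "s ^ 1 < s ^ n"
      using assms(2) by (intro power_strict_increasing) auto
    with True show ?thesis by simp
  next
    case False
    then have "s < 1" using \<open>s \<noteq> 1\<close> by simp
    then have "s ^ n < s ^ 1"
      using assms(2) \<open>0 < s\<close> by (intro power_strict_decreasing) auto
    with \<open>s < 1\<close> show ?thesis by (simp add: mult_neg_neg)
  qed
  then have "1 - s < (s - 1) * (s ^ n - s - 1)"
    by (simp add: algebra_simps)
  then have "(1 - s) / (2 * s) < (s - 1) * (s ^ n - s - 1) / (2 * s)"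
    using \<open>0 < s\<close> by (intro divide_strict_right_mono) auto
  also have "(s - 1) * (s ^ n - s - 1) / (2 * s) = Re x - Re x / s"
    using \<open>0 < s\<close> unfolding Re_x by (simp add: field_simps)
  also have "\<dots> = Re (x - inverse x)"
    by (simp add: s_def cmod_power2)
  finally have "(1 / s - 1) / 2 < Re (x - inverse x)"
    using \<open>0 < s\<close> by (simp add: diff_divide_distrib)
  moreover have "- ln (cmod x) \<le> (1 / s - 1) / 2"
  proof -
    have "- 2 * ln (cmod x) = ln (1 / s)"
      using \<open>x \<noteq> 0\<close> by (simp add: s_def ln_div ln_realpow)
    also have "\<dots> \<le> 1 / s - 1"
      using \<open>0 < s\<close> by (intro ln_le_minus_one) simp
    finally show ?thesis by simp
  qed
  ultimately show ?thesis by (rule le_less_trans[rotated])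
qed

text \<open>The product of the roots has modulus 1, so the lower bounds \<open>- ln \<bar>x\<bar>\<close> of the individual terms
  cancel in the sum.\<close>

lemma root_sum_pos:
  assumes roots: "\<And>x. poly p x = 0 \<Longrightarrow> x ^ n = x + 1" and "2 \<le> n"
    and "0 < degree p" and unit: "cmod (coeff p 0) = cmod (lead_coeff p)"
  shows "0 < Re (root_sum p)"
proof -
  let ?M = "proots p"
  have "p \<noteq> 0" using assms(3) by auto
  have mem: "x ^ n = x + 1" if "x \<in># ?M" for x
    using that roots \<open>p \<noteq> 0\<close> by simp
  then have nz: "0 \<notin># ?M" using mem[of 0] assms(2) by (auto simp: power_0_left)
  have ln_prod: "ln (cmod (\<Prod>x\<in>#N. - x)) = (\<Sum>x\<in>#N. ln (cmod x)) \<and> (\<Prod>x\<in>#N. - x) \<noteq> 0" if "0 \<notin># N" for N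
    using that by (induction N) (auto simp: norm_mult ln_mult)
  have "coeff p 0 = lead_coeff p * (\<Prod>x\<in>#?M. - x)"
    using coeffs_prod_linear(2)[of ?M] complex_poly_decompose_multiset[of p] by (metis coeff_smult)
  then have "cmod (\<Prod>x\<in>#?M. - x) = 1"
    using unit \<open>p \<noteq> 0\<close> by (simp add: norm_mult)
  then have "(\<Sum>x\<in>#?M. ln (cmod x)) = 0"
    using ln_prod[OF nz] by simp
  moreover have "- (\<Sum>x\<in>#N. ln (cmod x)) < Re (\<Sum>x\<in>#N. x - inverse x)"
    if "N \<noteq> {#}" "\<And>x. x \<in># N \<Longrightarrow> x ^ n = x + 1" for N
    using that
  proof (induction N)
    case (add x N)
    have "- ln (cmod x) < Re (x - inverse x)"
      using add.prems by (intro root_term_greater[of _ n] assms(2)) auto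
    moreover have "- (\<Sum>x\<in>#N. ln (cmod x)) \<le> Re (\<Sum>x\<in>#N. x - inverse x)"
      using add by (cases "N = {#}") (auto intro: less_imp_le)
    ultimately show ?case by simp
  qed simp
  moreover have "?M \<noteq> {#}"
    using assms(3) size_proots_complex[of p] by auto
  ultimately have "- 0 < Re (\<Sum>x\<in>#?M. x - inverse x)"
    using mem by metis
  then show ?thesis by (simp add: root_sum_def)
qed

definition selmer_poly :: "nat \<Rightarrow> int poly" where
  "selmer_poly n = monom 1 n - [:1, 1:]"

lemma poly_selmer_poly:
  "poly (map_poly of_int (selmer_poly n)) x = x ^ n - x - (1 :: 'a :: {comm_ring_1, ring_char_0})"
proof -
  have "map_poly of_int (selmer_poly n) = (monom 1 n - [:1, 1:] :: 'a poly)"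
    by (rule poly_eqI) (simp add: selmer_poly_def coeff_map_poly coeff_pCons split: nat.split)
  then show ?thesis by (simp add: poly_monom)
qed

lemma degree_selmer_poly:
  assumes "2 \<le> n"
  shows "degree (selmer_poly n) = n"
  using assms degree_add_eq_left[of "- [:1, 1:]" "monom 1 n :: int poly"]
  unfolding selmer_poly_def diff_conv_add_uminus by (simp add: degree_monom_eq del: minus_pCons)

text \<open>Selmer's theorem. The root sum of a nonconstant factor is a positive integer, so two nonconstant
  factors would contribute at least 2, but Vieta's formulas for \<open>x ^ n - x - 1\<close> give the total 1. The
  coefficient of \<open>x ^ (n - 1)\<close> has to vanish for this, which fails for \<open>n = 2\<close>.\<close>

lemma irreducible_selmer_poly:
  assumes "3 \<le> n"
  shows "irreducible (selmer_poly n)"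
proof (rule irreducibleI)
  let ?C = "map_poly of_int :: int poly \<Rightarrow> complex poly"
  have deg: "degree (selmer_poly n) = n" using assms by (simp add: degree_selmer_poly)
  show "selmer_poly n \<noteq> 0" using deg assms by auto
  show "\<not> selmer_poly n dvd 1"
    using deg assms by (auto simp: is_unit_poly_iff)
  fix g h assume f: "selmer_poly n = g * h"
  have degC: "degree (?C g) = degree g" for g
    by (simp add: degree_map_poly)
  have lcf: "lead_coeff (selmer_poly n) = 1" and c0: "coeff (selmer_poly n) 0 = - 1"
    and c1: "coeff (selmer_poly n) 1 = - 1" and cn: "coeff (pCons 0 (selmer_poly n)) n = 0"
    using assms unfolding deg by (auto simp: selmer_poly_def coeff_pCons split: nat.splits)
  have "lead_coeff g * lead_coeff h = 1"
    using lcf unfolding f by (simp add: lead_coeff_mult)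
  then have lc: "\<bar>lead_coeff g\<bar> = 1" "\<bar>lead_coeff h\<bar> = 1"
    by (auto simp: zmult_eq_1_iff)
  have "coeff g 0 * coeff h 0 = - 1"
    using c0 unfolding f by (simp add: coeff_mult)
  then have cc: "\<bar>coeff g 0\<bar> = 1" "\<bar>coeff h 0\<bar> = 1"
    by (metis abs_minus_cancel abs_mult abs_one abs_zmult_eq_1 mult.commute)+
  have nz: "?C (selmer_poly n) \<noteq> 0" "?C g \<noteq> 0" "?C h \<noteq> 0"
    using \<open>selmer_poly n \<noteq> 0\<close> f by (auto simp: map_poly_eq_0_iff)
  have total: "root_sum (?C (selmer_poly n)) = 1"
  proof -
    have "coeff (pCons 0 (?C (selmer_poly n))) n = 0"
      using cn assms by (cases n) (auto simp: coeff_map_poly)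
    then show ?thesis
      using c0 c1 lcf
      by (subst root_sum_coeffs) (auto simp: poly_0_coeff_0 coeff_map_poly degC deg)
  qed
  have sum: "root_sum (?C (selmer_poly n)) = root_sum (?C g) + root_sum (?C h)"
    using nz by (simp add: f of_int_poly_mult root_sum_def proots_mult)
  have ge_1: "1 \<le> Re (root_sum (?C k))"
    if k: "k dvd selmer_poly n" "0 < degree k" "\<bar>lead_coeff k\<bar> = 1" "\<bar>coeff k 0\<bar> = 1" for k
  proof -
    have "root_sum (?C k) \<in> \<int>"
    proof -
      have "lead_coeff k = 1 \<or> lead_coeff k = -1" "coeff k 0 = 1 \<or> coeff k 0 = -1"
        using k by linarith+
      moreover have "coeff (pCons 0 (?C k)) (degree k) \<in> \<int>"
        by (auto simp: coeff_pCons coeff_map_poly split: nat.split)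
      ultimately show ?thesis
        by (subst root_sum_coeffs) (auto simp: poly_0_coeff_0 coeff_map_poly degC)
    qed
    then obtain m where m: "root_sum (?C k) = of_int m" by (auto elim: Ints_cases)
    have "x ^ n = x + 1" if "poly (?C k) x = 0" for x
    proof -
      have "poly (?C (selmer_poly n)) x = 0"
        using that k(1) by (auto simp: of_int_poly_mult elim!: dvdE)
      then show ?thesis by (simp add: poly_selmer_poly algebra_simps)
    qed
    moreover have "cmod (coeff (?C k) 0) = cmod (lead_coeff (?C k))"
      using k by (simp add: coeff_map_poly degC flip: of_int_abs)
    ultimately have "0 < Re (root_sum (?C k))"
      using k(2) assms by (intro root_sum_pos[of _ n]) (auto simp: degC)
    then show ?thesis by (simp add: m)
  qed
  have "degree g = 0 \<or> degree h = 0"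
  proof (rule ccontr)
    assume "\<not> ?thesis"
    then have "1 \<le> Re (root_sum (?C g))" "1 \<le> Re (root_sum (?C h))"
      using lc cc f by (auto intro!: ge_1)
    with total sum have "(1 :: real) + 1 \<le> 1"
      by (metis add_mono one_complex.simps(1) plus_complex.simps(1))
    then show False by simp
  qed
  then show "g dvd 1 \<or> h dvd 1"
    using lc by (auto elim!: degree_eq_zeroE simp: is_unit_const_poly_iff)
qed

section \<open>Conjugates of a base with periodic expansion of one\<close>

text \<open>The orbit of one as a sequence of polynomials in the base, with the digits kept fixed. Evaluated
  at \<open>\<beta>\<close> it is the orbit itself; evaluated at a conjugate it is the orbit that the algebraic
  relations of \<open>\<beta>\<close> force on the conjugate.\<close>

primrec orbit_poly :: "real \<Rightarrow> nat \<Rightarrow> int poly" where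
  "orbit_poly \<beta> 0 = 1"
| "orbit_poly \<beta> (Suc k) = pCons (- expansion_of_one \<beta> k) (orbit_poly \<beta> k)"

lemma poly_orbit_poly_Suc:
  "poly (map_poly of_int (orbit_poly \<beta> (Suc k))) (x :: 'a :: comm_ring_1)
     = x * poly (map_poly of_int (orbit_poly \<beta> k)) x - of_int (expansion_of_one \<beta> k)"
  by (simp add: map_poly_pCons)

lemma poly_orbit_poly_self:
  assumes "1 < \<beta>"
  shows "poly (map_poly of_int (orbit_poly \<beta> k)) \<beta> = one_orbit \<beta> k"
proof (induction k)
  case (Suc k)
  then show ?case
    by (simp only: poly_orbit_poly_Suc one_orbit_Suc[OF assms])
qed simp

text \<open>A digit one is followed by an orbit point that is at most \<open>\<beta> - 1\<close>, and zeros follow until the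
  growth by powers of \<open>\<beta>\<close> carries it beyond \<open>1 / \<beta>\<close>.\<close>

lemma zero_block_after_one:
  assumes "1 < \<beta>" "\<beta> ^ p * (\<beta> - 1) \<le> 1" "expansion_of_one \<beta> k = 1" "i < p"
  shows "expansion_of_one \<beta> (Suc k + i) = 0"
  using assms(4)
proof (induction i rule: less_induct)
  case (less i)
  have "one_orbit \<beta> (Suc k) = \<beta> * one_orbit \<beta> k - 1"
    using one_orbit_Suc[OF assms(1), of k] assms(3) by simp
  also have "\<dots> \<le> \<beta> * 1 - 1"
    using assms(1) one_orbit_bounds[OF assms(1), of k]
    by (intro diff_right_mono mult_left_mono) auto
  finally have start: "one_orbit \<beta> (Suc k) \<le> \<beta> - 1" by simp
  have "\<beta> * one_orbit \<beta> (Suc k + i) = \<beta> ^ Suc i * one_orbit \<beta> (Suc k)"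
    using one_orbit_eq_zero_block[OF assms(1), of i "Suc k"] less by simp
  also have "\<dots> \<le> \<beta> ^ p * (\<beta> - 1)"
    using assms(1) start less.prems one_orbit_bounds[OF assms(1), of "Suc k"]
    by (intro mult_mono power_increasing) auto
  finally have "\<beta> * one_orbit \<beta> (Suc k + i) \<le> 1"
    using assms(2) by simp
  then have "\<lceil>\<beta> * one_orbit \<beta> (Suc k + i)\<rceil> \<le> 1"
    by (simp add: ceiling_le_iff)
  then show ?case
    using expansion_of_one_nonneg[OF assms(1), of "Suc k + i"]
      expansion_of_one_eq_ceiling[OF assms(1), of "Suc k + i"] by linarith
qed

text \<open>Let \<open>Z\<close> be the largest modulus in the conjugate orbit \<open>z\<close>, with \<open>r = \<bar>\<gamma>\<bar>\<close>. Moving forward through zeros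
  only increases the modulus, so \<open>Z\<close> is attained at a digit one, where
  \<open>r * Z \<le> 1 + \<bar>z (k + 1)\<bar>\<close>. The \<open>p\<close> zeros that follow multiply \<open>z (k + 1)\<close> by \<open>\<gamma> ^ p\<close>, which gives
  \<open>r ^ p * \<bar>z (k + 1)\<bar> \<le> Z\<close> and thus \<open>Z * (r ^ (p + 1) - 1) \<le> r ^ p\<close>. The same argument at the first digit,
  where \<open>z 1 = \<gamma> - 1\<close>, gives \<open>r ^ p * \<bar>\<gamma> - 1\<bar> \<le> Z\<close>. The two
  inequalities combine to the claim.\<close>

lemma conjugate_gap_bound:
  fixes \<gamma> :: complex
  assumes \<beta>: "1 < \<beta>" "\<beta> \<le> 2" and gap: "\<beta> ^ p * (\<beta> - 1) \<le> 1"
    and "M < N" and per: "\<And>j. expansion_of_one \<beta> (M + j) = expansion_of_one \<beta> (N + j)"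
    and conj: "\<And>P :: int poly. poly (map_poly of_int P) \<beta> = 0 \<Longrightarrow> poly (map_poly of_int P) \<gamma> = 0"
    and \<gamma>: "1 < cmod \<gamma>"
  shows "cmod (\<gamma> - 1) * (cmod \<gamma> ^ Suc p - 1) \<le> 1"
proof -
  let ?c = "expansion_of_one \<beta>" and ?r = "cmod \<gamma>"
  define z where "z k = poly (map_poly of_int (orbit_poly \<beta> k)) \<gamma>" for k
  have z_0: "z 0 = 1" by (simp add: z_def)
  have z_Suc: "z (Suc k) = \<gamma> * z k - of_int (?c k)" for k
    unfolding z_def by (rule poly_orbit_poly_Suc)
  have digit: "?c k \<in> {0, 1}" for k
  proof -
    have "of_int (?c k) < (2 :: real)" "0 \<le> ?c k"
      using expansion_of_one_less[OF \<beta>(1), of k] expansion_of_one_nonneg[OF \<beta>(1), of k] \<beta>(2) by auto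
    then show ?thesis by auto
  qed
  have zero_block: "z (k + j) = \<gamma> ^ j * z k" if "\<And>i. i < j \<Longrightarrow> ?c (k + i) = 0" for k j
    using that by (induction j) (auto simp: z_Suc)

  have "poly (map_poly of_int (orbit_poly \<beta> M - orbit_poly \<beta> N)) \<beta> = 0"
    using one_orbit_periodic[OF \<beta>(1) per] by (simp add: of_int_poly_diff poly_orbit_poly_self[OF \<beta>(1)])
  then have "z M = z N"
    using conj[of "orbit_poly \<beta> M - orbit_poly \<beta> N"] by (simp add: of_int_poly_diff z_def)
  then have z_per: "z (M + j) = z (N + j)" for j
    by (induction j) (simp_all add: z_Suc per)
  have "z k \<in> z ` {..<N}" for k
  proof (induction k rule: less_induct)
    case (less k)
    show ?case
    proof (cases "k < N")
      case False
      then have "z k = z (M + (k - N))" using z_per[of "k - N"] by simp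
      moreover have "M + (k - N) < k" using False \<open>M < N\<close> by linarith
      ultimately show ?thesis using less by simp
    qed auto
  qed
  then have "range z = z ` {..<N}" by blast
  then have fin: "finite (range (\<lambda>k. cmod (z k)))"
    by (metis finite_imageI finite_lessThan image_image)
  define Z where "Z = Max (range (\<lambda>k. cmod (z k)))"
  have z_le: "cmod (z k) \<le> Z" for k
    unfolding Z_def using fin by (intro Max_ge) auto
  obtain k where k: "Z = cmod (z k)"
    using Max_in[OF fin] unfolding Z_def by blast
  have after_one: "?r ^ p * cmod (z (Suc k)) \<le> Z" if "?c k = 1" for k
  proof -
    have "z (Suc k + p) = \<gamma> ^ p * z (Suc k)"
      using zero_block_after_one[OF \<beta>(1) gap that] by (intro zero_block) auto
    then have "?r ^ p * cmod (z (Suc k)) = cmod (z (Suc k + p))"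
      by (simp add: norm_mult norm_power)
    with z_le show ?thesis by simp
  qed

  \<comment> \<open>Move from the maximum forward to the next digit one.\<close>
  have ex: "\<exists>j. ?c (k + j) \<noteq> 0"
    by (rule expansion_of_one_nonzero_beyond[OF \<beta>(1)])
  define j where "j = (LEAST j. ?c (k + j) \<noteq> 0)"
  have "?c (k + j) \<noteq> 0" and before: "\<And>i. i < j \<Longrightarrow> ?c (k + i) = 0"
    unfolding j_def using LeastI_ex[OF ex] not_less_Least by blast+
  then have one: "?c (k + j) = 1" using digit by blast
  have "Z \<le> cmod (z (k + j))"
    using zero_block[OF before] \<gamma>
      mult_right_mono[OF one_le_power[of ?r j], of "cmod (z k)"] by (simp add: k norm_mult norm_power)
  then have "?r * Z \<le> ?r * cmod (z (k + j))"
    using \<gamma> by (intro mult_left_mono) auto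
  also have "\<dots> = cmod (1 + z (Suc (k + j)))"
    using one by (simp add: z_Suc norm_mult)
  also have "\<dots> \<le> 1 + cmod (z (Suc (k + j)))"
    using norm_triangle_ineq[of 1 "z (Suc (k + j))"] by simp
  finally have "?r ^ p * (?r * Z) \<le> ?r ^ p * (1 + cmod (z (Suc (k + j))))"
    using \<gamma> by (intro mult_left_mono) auto
  also have "\<dots> \<le> ?r ^ p + Z"
    using after_one[OF one] by (simp add: distrib_left)
  finally have Z: "Z * (?r ^ Suc p - 1) \<le> ?r ^ p"
    by (simp add: algebra_simps)

  have "?c 0 = 1"
    using expansion_of_one_first_pos[OF \<beta>(1)] digit[of 0] by auto
  then have "?r ^ p * cmod (\<gamma> - 1) \<le> Z"
    using after_one[of 0] by (simp add: z_Suc z_0)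
  then have "?r ^ p * cmod (\<gamma> - 1) * (?r ^ Suc p - 1) \<le> Z * (?r ^ Suc p - 1)"
    using one_le_power[of ?r "Suc p"] \<gamma> by (intro mult_right_mono) auto
  also note Z
  finally have "?r ^ p * (cmod (\<gamma> - 1) * (?r ^ Suc p - 1)) \<le> ?r ^ p * 1"
    by (simp add: mult.assoc)
  moreover have "0 < ?r ^ p"
    using \<gamma> by (intro zero_less_power) linarith
  ultimately show ?thesis by (rule mult_left_le_imp_le)
qed

section \<open>A conjugate close to the positive axis\<close>

text \<open>Let \<open>\<gamma> = r * cis t\<close>. In the triangle with vertices \<open>0\<close>, \<open>1\<close> and \<open>\<gamma> + 1\<close> the angle at \<open>0\<close> is the
  argument \<open>\<psi>\<close> of \<open>\<gamma> + 1\<close>, so the law of sines gives \<open>r = sin \<psi> / sin (t - \<psi>)\<close> and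
  \<open>\<bar>\<gamma> + 1\<bar> = sin t / sin (t - \<psi>)\<close>. With \<open>\<psi> = n * t - 2 * pi\<close> the arguments of \<open>\<gamma> ^ n\<close> and \<open>\<gamma> + 1\<close>
  agree, and equality of the moduli becomes one real equation for \<open>t\<close>, which the intermediate
  value theorem solves between \<open>2 * pi / n\<close> and \<open>2 * pi / (n - 1)\<close>. For \<open>n \<ge> 5\<close> the angle \<open>t\<close> is acute; this
  gives \<open>r > 1\<close>, and the moduli of \<open>\<gamma> + 1\<close> and \<open>\<gamma> - 1\<close> are then at least those of \<open>cis t + 1\<close> and
  \<open>cis t - 1\<close>.\<close>

lemma trinomial_root_first_sector:
  assumes "5 \<le> n"
  obtains \<gamma> :: complex where "\<gamma> ^ n = \<gamma> + 1" "1 < cmod \<gamma>"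
    "2 * cos (pi / (real n - 1)) \<le> cmod \<gamma> ^ n" "2 * sin (pi / real n) \<le> cmod (\<gamma> - 1)"
proof -
  define N where "N = real n"
  define a where "a = 2 * pi / N"
  define b where "b = 2 * pi / (N - 1)"
  have N: "5 \<le> N" "real (n - 1) = N - 1" using assms by (auto simp: N_def)
  have ab: "0 < a" "a < b" "b \<le> pi / 2"
    using N by (auto simp: a_def b_def field_simps)
  have Na: "N * a = 2 * pi" and Nb: "(N - 1) * b = 2 * pi"
    using N by (auto simp: a_def b_def)
  define h where "h = (\<lambda>t. sin (N * t) ^ n - sin t * (- sin ((N - 1) * t)) ^ (n - 1))"
  have pow: "x * x ^ (n - 1) = x ^ n" for x :: real
    using assms by (cases n) auto
  have "(N - 1) * a = 2 * pi - a" using Na by (simp add: algebra_simps)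
  then have ha: "h a = - (sin a ^ n)"
    using assms pow by (simp add: h_def Na sin_diff)
  have "N * b = b + 2 * pi" using Nb by (simp add: algebra_simps)
  then have hb: "h b = sin b ^ n"
    using assms by (simp add: h_def Nb)
  have "0 < sin a" "0 < sin b"
    using ab pi_gt_zero by (auto intro!: sin_gt_zero)
  then have sgn: "h a < 0" "0 < h b"
    by (simp_all add: ha hb)
  have "\<exists>t. a \<le> t \<and> t \<le> b \<and> h t = 0"
  proof (rule IVT')
    show "continuous_on {a..b} h"
      unfolding h_def by (intro continuous_intros)
  qed (use sgn ab in auto)
  then obtain t where t: "a \<le> t" "t \<le> b" "h t = 0" by blast
  with sgn have "a < t" "t < b"
    by (auto simp: less_le)
  define S where "S = sin (N * t)"
  define T where "T = - sin ((N - 1) * t)"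
  have "N * a < N * t" "(N - 1) * t < (N - 1) * b" "(N - 1) * a < (N - 1) * t"
    using \<open>a < t\<close> \<open>t < b\<close> N by auto
  then have \<psi>: "0 < N * t - 2 * pi" "N * t - 2 * pi < t" "0 < 2 * pi - (N - 1) * t" "2 * pi - (N - 1) * t < a"
    using Na Nb by (auto simp: algebra_simps)
  have "S = sin (N * t - 2 * pi)" "T = sin (2 * pi - (N - 1) * t)"
    by (simp_all add: S_def T_def sin_diff)
  moreover have "0 < sin (N * t - 2 * pi)" "0 < sin (2 * pi - (N - 1) * t)"
    using \<psi> ab t pi_gt_zero by (intro sin_gt_zero; linarith)+
  ultimately have ST: "0 < S" "0 < T" by simp_all
  have trig: "S ^ n = sin t * T ^ (n - 1)"
    using t(3) by (simp add: h_def S_def T_def)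
  define r where "r = S / T"
  define \<gamma> where "\<gamma> = of_real r * cis t"
  have "0 < r" using ST by (simp add: r_def)
  have \<gamma>_Re: "Re \<gamma> = r * cos t" and \<gamma>_Im: "Im \<gamma> = r * sin t"
    by (simp_all add: \<gamma>_def)
  have cmod_\<gamma>: "cmod \<gamma> = r"
    using \<open>0 < r\<close> by (simp add: \<gamma>_def norm_mult)
  have T_expand: "T = - (S * cos t - cos (N * t) * sin t)"
  proof -
    have "(N - 1) * t = N * t - t" by (simp add: algebra_simps)
    then show ?thesis by (simp add: T_def S_def sin_diff)
  qed
  have "of_real T * (\<gamma> + 1) = of_real (sin t) * cis (N * t)"
  proof -
    have "T * r = S" using ST by (simp add: r_def)
    then have "T * (r * cos t) = S * cos t" "T * (r * sin t) = S * sin t"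
      by (metis mult.assoc)+
    then show ?thesis
      using T_expand by (simp add: complex_eq_iff \<gamma>_Re \<gamma>_Im distrib_left S_def)
  qed
  moreover have "of_real T * \<gamma> ^ n = of_real (sin t) * cis (N * t)"
  proof -
    have "T * r ^ n = sin t"
      using ST assms trig pow[of T] by (simp add: r_def power_divide field_simps)
    moreover have "cis t ^ n = cis (N * t)"
      by (simp add: Complex.DeMoivre N_def)
    ultimately show ?thesis
      by (simp add: \<gamma>_def power_mult_distrib flip: mult.assoc of_real_power of_real_mult)
  qed
  ultimately have root: "\<gamma> ^ n = \<gamma> + 1"
    using ST by (metis less_irrefl mult_left_cancel of_real_eq_0_iff)

  have cos_t: "0 < cos t"
    using \<open>a < t\<close> \<open>t < b\<close> ab by (intro cos_gt_zero) auto
  have rn: "r ^ n = cmod (\<gamma> + 1)"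
    by (metis root norm_power cmod_\<gamma>)
  have "1 < Re (\<gamma> + 1)" using cos_t \<open>0 < r\<close> by (simp add: \<gamma>_Re)
  also have "\<dots> \<le> r ^ n" unfolding rn by (rule complex_Re_le_cmod)
  finally have "1 < r ^ n" .
  have "1 < r"
  proof (rule ccontr)
    assume "\<not> 1 < r"
    then have "r ^ n \<le> 1" using \<open>0 < r\<close> by (intro power_le_one) auto
    with \<open>1 < r ^ n\<close> show False by simp
  qed
  have half_cos: "cos t = 2 * (cos (t / 2))\<^sup>2 - 1"
    using cos_double_cos[of "t / 2"] by simp
  have half_sin: "cos t = 1 - 2 * (sin (t / 2))\<^sup>2"
    using cos_double_sin[of "t / 2"] by simp
  have circle: "(r * cos t)\<^sup>2 + (r * sin t)\<^sup>2 = r\<^sup>2"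
    by (simp add: power_mult_distrib flip: distrib_left)
  have sq1: "(cmod (\<gamma> + 1))\<^sup>2 = r\<^sup>2 + 2 * r * cos t + 1"
    using circle by (simp add: cmod_power2 \<gamma>_Re \<gamma>_Im power2_sum)
  have sq2: "(cmod (\<gamma> - 1))\<^sup>2 = r\<^sup>2 - 2 * r * cos t + 1"
    using circle by (simp add: cmod_power2 \<gamma>_Re \<gamma>_Im power2_diff)
  have "2 * cos (t / 2) \<le> r ^ n"
  proof (rule power2_le_imp_le)
    have "(2 * cos (t / 2))\<^sup>2 = 1 + 2 * cos t + 1"
      using half_cos by (simp add: power_mult_distrib)
    also have "\<dots> \<le> r\<^sup>2 + 2 * r * cos t + 1"
      using \<open>1 < r\<close> cos_t by (intro add_mono) (auto simp: one_le_power)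
    finally show "(2 * cos (t / 2))\<^sup>2 \<le> (r ^ n)\<^sup>2"
      unfolding rn sq1 .
  qed (use \<open>0 < r\<close> in simp)
  moreover have "cos (pi / (N - 1)) \<le> cos (t / 2)"
  proof -
    have "t / 2 \<le> pi / (N - 1)" using t by (simp add: b_def mult.commute)
    moreover have "pi / (N - 1) \<le> pi" using ab by (simp add: b_def)
    ultimately show ?thesis
      using t ab by (intro cos_monotone_0_pi_le) auto
  qed
  ultimately have c: "2 * cos (pi / (real n - 1)) \<le> cmod \<gamma> ^ n"
    by (simp add: cmod_\<gamma> N_def)
  have "2 * sin (t / 2) \<le> cmod (\<gamma> - 1)"
  proof (rule power2_le_imp_le)
    have "(2 * sin (t / 2))\<^sup>2 = 2 * (1 - cos t)"
      using half_sin by (simp add: power_mult_distrib)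
    also have "\<dots> \<le> 2 * r * (1 - cos t)"
      using \<open>1 < r\<close> by (intro mult_right_mono) auto
    also have "\<dots> \<le> (r - 1)\<^sup>2 + 2 * r * (1 - cos t)"
      by simp
    also have "\<dots> = r\<^sup>2 - 2 * r * cos t + 1"
      by (simp add: power2_eq_square algebra_simps)
    finally show "(2 * sin (t / 2))\<^sup>2 \<le> (cmod (\<gamma> - 1))\<^sup>2"
      unfolding sq2 .
  qed simp
  moreover have "sin (pi / N) \<le> sin (t / 2)"
    using t ab by (intro sin_monotone_2pi_le) (auto simp: a_def mult.commute)
  ultimately have s: "2 * sin (pi / real n) \<le> cmod (\<gamma> - 1)"
    by (simp add: N_def)
  show ?thesis
    using that[OF root _ c s] \<open>1 < r\<close> cmod_\<gamma> by simp
qed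

text \<open>The quartic splits over the reals as \<open>x ^ 4 - x - 1 = (x\<^sup>2 + a * x + b) * (x\<^sup>2 - a * x + d)\<close> where
  \<open>a ^ 6 + 4 * a\<^sup>2 = 1\<close> and \<open>2 * b = a\<^sup>2 + 1 / a\<close>. The first factor has the conjugate pair of roots, and
  their moduli are read off as \<open>\<bar>\<gamma>\<bar>\<^sup>2 = b\<close> and \<open>\<bar>\<gamma> - 1\<bar>\<^sup>2 = 1 + a + b\<close>. The product to be bounded is only
  slightly larger than 1, which is why \<open>a\<close> has to be enclosed so tightly.\<close>

lemma quartic_root_far_from_one:
  obtains \<gamma> :: complex where "\<gamma> ^ 4 = \<gamma> + 1" "1 < cmod \<gamma>" "1 < cmod (\<gamma> - 1) * (cmod \<gamma> ^ 8 - 1)"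
proof -
  have "\<exists>a. 496 / 1000 \<le> a \<and> a \<le> 4966 / 10000 \<and> a ^ 6 + 4 * a\<^sup>2 = (1 :: real)"
    by (rule IVT') (auto intro!: continuous_intros simp: power_divide)
  then obtain a :: real where a: "496 / 1000 \<le> a" "a \<le> 4966 / 10000" "a ^ 6 + 4 * a\<^sup>2 = 1"
    by blast
  define b where "b = (a\<^sup>2 + 1 / a) / 2"
  have "(496 / 1000)\<^sup>2 \<le> a\<^sup>2" using a by (intro power_mono) auto
  moreover have "10000 / 4966 \<le> 1 / a" using a by (simp add: field_simps)
  ultimately have b: "112984 / 100000 \<le> b"
    unfolding b_def by (simp add: power_divide)
  have "a\<^sup>2 \<le> 1" using a by (intro power_le_one) auto
  define \<gamma> where "\<gamma> = Complex (- a / 2) (sqrt (b - a\<^sup>2 / 4))"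
  have disc: "0 \<le> b - a\<^sup>2 / 4" using b \<open>a\<^sup>2 \<le> 1\<close> by simp
  have quad: "\<gamma>\<^sup>2 = - of_real a * \<gamma> - of_real b"
    using disc by (simp add: complex_eq_iff \<gamma>_def power2_eq_square algebra_simps)
  have c1: "2 * a * b - a ^ 3 = 1"
    using a by (simp add: b_def field_simps power2_eq_square power3_eq_cube)
  have c0: "b\<^sup>2 - a\<^sup>2 * b = 1"
  proof -
    have "4 * a\<^sup>2 * (b\<^sup>2 - a\<^sup>2 * b) = (2 * a * b)\<^sup>2 - 2 * a ^ 3 * (2 * a * b)"
      by (simp add: power2_eq_square power3_eq_cube algebra_simps)
    also have "2 * a * b = 1 + a ^ 3" using c1 by simp
    also have "(1 + a ^ 3)\<^sup>2 - 2 * a ^ 3 * (1 + a ^ 3) = 1 - a ^ 6"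
      by algebra
    finally have "4 * a\<^sup>2 * (b\<^sup>2 - a\<^sup>2 * b) = 4 * a\<^sup>2 * 1" using a by simp
    then show ?thesis using a by simp
  qed
  have "\<gamma> ^ 4 = of_real (2 * a * b - a ^ 3) * \<gamma> + of_real (b\<^sup>2 - a\<^sup>2 * b)"
  proof -
    have "\<gamma> ^ 4 = (\<gamma>\<^sup>2)\<^sup>2" by algebra
    also have "\<dots> = (- of_real a * \<gamma> - of_real b)\<^sup>2"
      by (simp only: quad)
    also have "\<dots> = of_real a ^ 2 * \<gamma>\<^sup>2 + 2 * of_real a * of_real b * \<gamma> + of_real b ^ 2"
      by algebra
    also have "\<dots> = of_real (2 * a * b - a ^ 3) * \<gamma> + of_real (b\<^sup>2 - a\<^sup>2 * b)"
      unfolding quad by (simp add: algebra_simps power2_eq_square power3_eq_cube)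
    finally show ?thesis .
  qed
  then have root: "\<gamma> ^ 4 = \<gamma> + 1" by (simp only: c0 c1) simp
  have sq: "(cmod \<gamma>)\<^sup>2 = b" "(cmod (\<gamma> - 1))\<^sup>2 = 1 + a + b"
    using disc unfolding cmod_power2 by (simp_all add: \<gamma>_def power2_eq_square field_simps)
  have "(1 :: real)\<^sup>2 < (cmod \<gamma>)\<^sup>2" using sq b by simp
  then have "1 < cmod \<gamma>" by (rule power_less_imp_less_base) simp
  have "(112984 / 100000) ^ 4 \<le> b ^ 4"
    using b by (intro power_mono) auto
  then have "0.6295 \<le> b ^ 4 - 1" by (simp add: power_divide)
  moreover have "b ^ 4 = cmod \<gamma> ^ 8"
    by (simp flip: sq(1) power_mult)
  moreover have "1.62 \<le> cmod (\<gamma> - 1)"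
    by (rule power2_le_imp_le) (use sq a b in \<open>auto simp: power_divide power2_eq_square\<close>)
  ultimately have "1.62 * 0.6295 \<le> cmod (\<gamma> - 1) * (cmod \<gamma> ^ 8 - 1)"
    by (intro mult_mono) auto
  then have "1 < cmod (\<gamma> - 1) * (cmod \<gamma> ^ 8 - 1)" by simp
  with that[OF root \<open>1 < cmod \<gamma>\<close>] show ?thesis .
qed

text \<open>Both bounds compare \<open>sin (pi / 6) = 1 / 2\<close> with elementary bounds of the sine; the upper one
  evaluates a Taylor polynomial at \<open>3.15 / 6 = 21 / 40\<close>.\<close>

lemma pi_bounds: "3 \<le> pi" "pi < 3.15"
proof -
  have "sin (pi / 6) \<le> pi / 6" by (intro sin_x_le_x) simp
  then show "3 \<le> pi" by (simp add: sin_30)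
  have "\<bar>sin (21/40) - (\<Sum>m<5. sin_coeff m * (21/40) ^ m)\<bar> \<le> inverse (fact 5) * \<bar>21/40\<bar> ^ 5"
    by (rule Maclaurin_sin_bound)
  then have "(\<Sum>m<5. sin_coeff m * (21/40) ^ m) - inverse (fact 5) * \<bar>21/40\<bar> ^ 5 \<le> sin (21/40 :: real)"
    unfolding abs_le_iff by linarith
  then have "1 / 2 < sin (21 / 40 :: real)"
    by (simp add: sin_coeff_def lessThan_nat_numeral fact_numeral power_divide)
  moreover have "sin (21 / 40) \<le> sin (pi / 6)" if "21 / 40 \<le> pi / 6"
    using that pi_ge_two by (intro sin_monotone_2pi_le) auto
  ultimately show "pi < 3.15" by (fastforce simp: sin_30)
qed

lemma mult_cos_le_sin:
  assumes "0 \<le> (x :: real)" "x \<le> pi"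
  shows "x * cos x \<le> sin x"
proof -
  have "(\<lambda>x. sin x - x * cos x) 0 \<le> (\<lambda>x. sin x - x * cos x) x"
  proof (rule DERIV_nonneg_imp_nondecreasing[OF assms(1)])
    fix y :: real assume "0 \<le> y" "y \<le> x"
    then have "0 \<le> y * sin y" using assms by (intro mult_nonneg_nonneg sin_ge_zero) auto
    moreover have "((\<lambda>x. sin x - x * cos x) has_real_derivative y * sin y) (at y)"
      by (auto intro!: derivative_eq_intros)
    ultimately show "\<exists>D. ((\<lambda>x. sin x - x * cos x) has_real_derivative D) (at y) \<and> 0 \<le> D" by blast
  qed
  then show ?thesis by simp
qed

lemma cos_lower_bound:
  fixes x :: real
  shows "1 - x\<^sup>2 / 2 \<le> cos x"
proof -
  have "\<bar>sin (x / 2)\<bar> \<le> \<bar>x / 2\<bar>" by (rule abs_sin_x_le_abs_x)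
  then have "(sin (x / 2))\<^sup>2 \<le> (x / 2)\<^sup>2" by (metis abs_le_square_iff)
  then show ?thesis
    using cos_double_sin[of "x / 2"] by (simp add: power_divide)
qed

section \<open>The conjugate violates the gap bound\<close>

lemma second_order_Bernoulli:
  fixes x :: real
  assumes "0 \<le> x"
  shows "1 + real n * x + real n * (real n - 1) / 2 * x\<^sup>2 \<le> (1 + x) ^ n"
proof (induction n)
  case (Suc n)
  have "0 \<le> real n * (real n - 1) / 2 * x ^ 3"
    using assms by (cases n) auto
  then have "1 + real (Suc n) * x + real (Suc n) * (real (Suc n) - 1) / 2 * x\<^sup>2
      \<le> (1 + x) * (1 + real n * x + real n * (real n - 1) / 2 * x\<^sup>2)"
    by (simp add: field_simps power2_eq_square power3_eq_cube)
  also have "\<dots> \<le> (1 + x) * (1 + x) ^ n"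
    using assms Suc by (intro mult_left_mono) auto
  finally show ?case by simp
qed simp

text \<open>The first-order Bernoulli inequality yields only the bound \<open>1 + 1 / (n - 1)\<close>; with the quadratic term
  the slightly better one follows.\<close>

lemma trinomial_real_root_le:
  fixes \<beta> :: real
  assumes "4 \<le> n" "1 < \<beta>" "\<beta> ^ n = \<beta> + 1"
  shows "\<beta> \<le> 1 + 1 / real n"
proof (rule ccontr)
  define x where "x = \<beta> - 1"
  assume "\<not> ?thesis"
  then have x: "1 / real n < x" by (simp add: x_def)
  have "1 + real n * x + real n * (real n - 1) / 2 * x\<^sup>2 \<le> 2 + x"
    using second_order_Bernoulli[of x n] assms by (simp add: x_def)
  then have le: "(real n - 1) * x + real n * (real n - 1) / 2 * x\<^sup>2 \<le> 1"
    by (simp add: algebra_simps)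
  have "(real n - 1) * (1 / real n) + real n * (real n - 1) / 2 * (1 / real n)\<^sup>2
      \<le> (real n - 1) * x + real n * (real n - 1) / 2 * x\<^sup>2"
    using assms(1) x by (intro add_mono mult_left_mono power_mono) auto
  with le have "(real n - 1) * (1 / real n) + real n * (real n - 1) / 2 * (1 / real n)\<^sup>2 \<le> 1"
    by simp
  then have "3 * (real n - 1) \<le> 2 * real n"
    using assms(1) by (simp add: field_simps power2_eq_square)
  with assms(1) show False by simp
qed

text \<open>The left side bounds \<open>\<beta> + 1 = \<beta> ^ n\<close> from above and the cosine term bounds \<open>r ^ n\<close> from below for the
  conjugate of modulus \<open>r\<close>, so this compares \<open>\<beta> ^ n\<close> with \<open>r ^ n\<close>. At \<open>n = 6\<close> a constant below 2.03
  would fail, and the loss in the logarithm computed from it below has to stay less than 1, which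
  leaves room only for constants slightly above 2.11.\<close>

lemma first_sector_cos_bound:
  assumes "6 \<le> n"
  shows "2 + 1 / real n \<le> (1 + 2.11 / real n) * (2 * cos (pi / (real n - 1)))"
proof -
  define N where "N = real n"
  have N: "6 \<le> N" using assms by (simp add: N_def)
  have "pi\<^sup>2 \<le> 3.15\<^sup>2"
    using pi_bounds by (intro power_mono) auto
  moreover have "25 / 6 * N \<le> (N - 1)\<^sup>2"
  proof -
    have "0 \<le> (N - 6) * (6 * N - 1)" using N by simp
    then show ?thesis by (simp add: power2_eq_square algebra_simps)
  qed
  ultimately have "pi\<^sup>2 / (N - 1)\<^sup>2 \<le> 3.15\<^sup>2 / (25 / 6 * N)"
    using N by (intro frac_le) auto
  also have "\<dots> \<le> 2.382 / N"
    using N by (simp add: field_simps power2_eq_square)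
  finally have "(pi / (N - 1))\<^sup>2 \<le> 2.382 / N"
    by (simp add: power_divide)
  then have C: "1 - 1.191 / N \<le> cos (pi / (N - 1))"
    using cos_lower_bound[of "pi / (N - 1)"] by simp
  have "2 + 1 / N \<le> (1 + 2.11 / N) * (2 * (1 - 1.191 / N))"
    using N by (simp add: field_simps)
  also have "\<dots> \<le> (1 + 2.11 / N) * (2 * cos (pi / (N - 1)))"
    using C N by (intro mult_left_mono) auto
  finally show ?thesis by (simp add: N_def)
qed

text \<open>By the choice of \<open>m\<close> the power \<open>\<beta> ^ m\<close> is at least \<open>n\<close>. Replacing \<open>\<beta>\<close> by \<open>r\<close> multiplies the logarithm
  of this power by \<open>R / L\<close>, which is at least \<open>1 - 2.11 / (n * L)\<close>; for \<open>n \<ge> 6\<close> this costs less than 1 in the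
  logarithm, hence a factor of less than \<open>exp 1\<close> in the power.\<close>

lemma conjugate_power_large:
  fixes \<beta> r :: real
  assumes "6 \<le> n" and \<beta>: "1 < \<beta>" "\<beta> ^ n = \<beta> + 1" and m: "1 \<le> \<beta> ^ m * (\<beta> - 1)"
    and r: "1 < r" "2 * cos (pi / (real n - 1)) \<le> r ^ n"
  shows "real n / 2.72 < r ^ m"
proof -
  define N where "N = real n"
  have N: "6 \<le> N" using assms(1) by (simp add: N_def)
  define L where "L = N * ln \<beta>"
  define R where "R = N * ln r"
  have L: "L = ln (\<beta> + 1)"
    using \<beta> by (simp add: L_def N_def flip: ln_realpow \<beta>(2))
  have R: "R = ln (r ^ n)"
    using r by (simp add: R_def N_def ln_realpow)
  have "0 < R" using r N by (simp add: R_def)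
  have "ln 2 \<le> L" using \<beta> by (simp add: L)
  then have "2 / 3 \<le> L" using ln2_ge_two_thirds by linarith
  have \<beta>_le: "\<beta> \<le> 1 + 1 / N"
    using trinomial_real_root_le[of n \<beta>] assms by (simp add: N_def)

  have "\<beta> + 1 \<le> 2 + 1 / N" using \<beta>_le by simp
  also have "\<dots> \<le> (1 + 2.11 / N) * (2 * cos (pi / (N - 1)))"
    using first_sector_cos_bound[OF assms(1)] by (simp add: N_def)
  also have "\<dots> \<le> (1 + 2.11 / N) * r ^ n"
    using r N by (intro mult_left_mono) (auto simp: N_def)
  finally have "ln (\<beta> + 1) \<le> ln ((1 + 2.11 / N) * r ^ n)"
    using \<beta> r N by (subst ln_le_cancel_iff) (auto intro!: mult_pos_pos add_pos_nonneg)
  also have "\<dots> = ln (1 + 2.11 / N) + R"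
    using r N unfolding R by (intro ln_mult_pos) (auto intro!: add_pos_nonneg)
  also have "ln (1 + 2.11 / N) \<le> 2.11 / N"
    using N by (intro ln_add_one_self_le_self) simp
  finally have "L - R \<le> 2.11 / N" by (simp add: L)

  have "N \<le> \<beta> ^ m"
  proof -
    have "1 \<le> \<beta> ^ m * (1 / N)"
      using m mult_left_mono[of "\<beta> - 1" "1 / N" "\<beta> ^ m"] \<beta> \<beta>_le by simp
    then show ?thesis using N by (simp add: field_simps)
  qed
  then have "ln N \<le> real m * ln \<beta>"
    using N \<beta> by (metis ln_realpow ln_le_cancel_iff less_le_trans zero_less_numeral zero_less_one less_trans zero_less_power)
  have "0 \<le> ln N" using N by simp
  have "ln N = ln (N / 4) + 2 * ln 2"
    using N by (simp add: ln_div ln_realpow[of 2 2, simplified])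
  also have "\<dots> \<le> (N / 4 - 1) + 2 * (25 / 36)"
    using N ln2_le_25_over_36 by (intro add_mono mult_left_mono ln_le_minus_one) auto
  finally have ln_N: "ln N \<le> N / 4 + 7 / 18" by simp

  have "ln N * (L - R) / L \<le> ln N * (2.11 / N) / (2 / 3)"
  proof -
    have "ln N * (L - R) / L \<le> ln N * (2.11 / N) / L"
      using \<open>0 \<le> ln N\<close> \<open>L - R \<le> 2.11 / N\<close> \<open>2 / 3 \<le> L\<close> by (intro divide_right_mono mult_left_mono) auto
    also have "\<dots> \<le> ln N * (2.11 / N) / (2 / 3)"
      using \<open>0 \<le> ln N\<close> N \<open>2 / 3 \<le> L\<close> by (intro divide_left_mono) auto
    finally show ?thesis .
  qed
  also have "\<dots> \<le> (N / 4 + 7 / 18) * (2.11 / N) / (2 / 3)"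
    using ln_N N by (intro divide_right_mono mult_right_mono) auto
  also have "\<dots> < 1" using N by (simp add: field_simps)
  finally have loss: "ln N * (L - R) / L < 1" .

  have "ln N - 1 < ln N - ln N * (L - R) / L" using loss by simp
  also have "\<dots> = ln N * (R / L)"
    using \<open>2 / 3 \<le> L\<close> by (simp add: field_simps)
  also have "\<dots> \<le> real m * ln \<beta> * (R / L)"
    using \<open>ln N \<le> real m * ln \<beta>\<close> \<open>0 < R\<close> \<open>2 / 3 \<le> L\<close> by (intro mult_right_mono) auto
  also have "\<dots> = real m * ln r"
    using N \<beta> by (simp add: R_def L_def field_simps)
  also have "\<dots> = ln (r ^ m)" using r by (simp add: ln_realpow)
  finally have "exp (ln N - 1) < exp (ln (r ^ m))" by simp
  then have "N / exp 1 < r ^ m" using N r by (simp add: exp_diff)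
  moreover have "N / 2.72 \<le> N / exp 1"
    using N e_less_272 by (intro divide_left_mono) auto
  ultimately show ?thesis
    unfolding N_def by (rule le_less_trans[rotated])
qed

text \<open>In each case \<open>p + 1\<close> is chosen as an exponent for which \<open>\<bar>\<gamma>\<bar> ^ (p + 1)\<close> is large although the gap
  condition still holds for \<open>p\<close>. For \<open>n \<ge> 6\<close> it is the least \<open>m\<close> with \<open>\<beta> ^ m * (\<beta> - 1) \<ge> 1\<close>.\<close>

lemma trinomial_conjugate_beyond_gap:
  fixes \<beta> :: real
  assumes "4 \<le> n" "1 < \<beta>" "\<beta> ^ n = \<beta> + 1"
  obtains \<gamma> :: complex and p where "\<gamma> ^ n = \<gamma> + 1" "1 < cmod \<gamma>"
    "\<beta> ^ p * (\<beta> - 1) \<le> 1" "1 < cmod (\<gamma> - 1) * (cmod \<gamma> ^ Suc p - 1)"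
proof -
  have small: "\<beta> < d" if "d + 1 < d ^ n" "1 < d" for d
  proof (rule ccontr)
    assume "\<not> \<beta> < d"
    obtain k where n: "n = Suc k" using assms(1) by (cases n) auto
    have "d ^ k \<le> \<beta> ^ k" using \<open>\<not> \<beta> < d\<close> \<open>1 < d\<close> by (intro power_mono) auto
    moreover have "1 \<le> d ^ k" using \<open>1 < d\<close> by (intro one_le_power) auto
    ultimately have "d * (d ^ k - 1) \<le> \<beta> * (\<beta> ^ k - 1)"
      using \<open>\<not> \<beta> < d\<close> \<open>1 < d\<close> by (intro mult_mono) auto
    with assms(3) that(1) show False by (simp add: n algebra_simps)
  qed
  consider "n = 4" | "n = 5" | "6 \<le> n" using assms(1) by linarith
  then show ?thesis
  proof cases
    case 1
    have "\<beta> < 1221 / 1000"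
      using 1 by (intro small) (auto simp: power_divide)
    then have "\<beta> ^ 7 * (\<beta> - 1) \<le> (1221 / 1000) ^ 7 * (1221 / 1000 - 1)"
      using assms(2) by (intro mult_mono power_mono) auto
    then have gap: "\<beta> ^ 7 * (\<beta> - 1) \<le> 1" by (simp add: power_divide)
    obtain \<gamma> :: complex where "\<gamma> ^ 4 = \<gamma> + 1" "1 < cmod \<gamma>" "1 < cmod (\<gamma> - 1) * (cmod \<gamma> ^ 8 - 1)"
      by (rule quartic_root_far_from_one)
    then show ?thesis
      using that[of \<gamma> 7] gap 1 by simp
  next
    case 2
    have "\<beta> < 117 / 100"
      using 2 by (intro small) (auto simp: power_divide)
    then have "\<beta> ^ 10 * (\<beta> - 1) \<le> (117 / 100) ^ 10 * (117 / 100 - 1)"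
      using assms(2) by (intro mult_mono power_mono) auto
    then have gap: "\<beta> ^ 10 * (\<beta> - 1) \<le> 1" by (simp add: power_divide)
    have "5 \<le> n" using 2 by simp
    then obtain \<gamma> :: complex where \<gamma>: "\<gamma> ^ n = \<gamma> + 1" "1 < cmod \<gamma>"
      "2 * cos (pi / (real n - 1)) \<le> cmod \<gamma> ^ n" "2 * sin (pi / real n) \<le> cmod (\<gamma> - 1)"
      by (rule trinomial_root_first_sector)
    have "sin (pi / 6) \<le> sin (pi / 5)" by (intro sin_monotone_2pi_le) auto
    then have dist: "1 \<le> cmod (\<gamma> - 1)" using \<gamma>(4) 2 by (simp add: sin_30)
    have "(sqrt 2)\<^sup>2 \<le> (cmod \<gamma> ^ 5)\<^sup>2"
      using \<gamma>(3) 2 by (intro power_mono) (auto simp: cos_45)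
    then have "2 \<le> cmod \<gamma> ^ 10" by (simp flip: power_mult)
    then have "2 * 1 < cmod \<gamma> ^ 10 * cmod \<gamma>"
      using \<gamma>(2) by (intro mult_le_less_imp_less) auto
    then have "1 < cmod \<gamma> ^ Suc 10 - 1" by (simp only: power_Suc2)
    then have "1 * 1 < cmod (\<gamma> - 1) * (cmod \<gamma> ^ Suc 10 - 1)"
      using dist by (intro mult_le_less_imp_less) auto
    then show ?thesis
      using that[OF \<gamma>(1,2) gap] by simp
  next
    case 3
    define N where "N = real n"
    have N: "6 \<le> N" using 3 by (simp add: N_def)
    have \<beta>_le: "\<beta> \<le> 1 + 1 / N"
      using trinomial_real_root_le[OF assms] by (simp add: N_def)
    have ex: "\<exists>m. 1 \<le> \<beta> ^ m * (\<beta> - 1)"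
    proof -
      obtain m where "1 / (\<beta> - 1) < \<beta> ^ m" using real_arch_pow[OF assms(2)] by blast
      then have "1 \<le> \<beta> ^ m * (\<beta> - 1)" using assms(2) by (simp add: field_simps)
      then show ?thesis ..
    qed
    define m where "m = (LEAST m. 1 \<le> \<beta> ^ m * (\<beta> - 1))"
    have m: "1 \<le> \<beta> ^ m * (\<beta> - 1)"
      and least: "\<And>k. k < m \<Longrightarrow> \<not> 1 \<le> \<beta> ^ k * (\<beta> - 1)"
      unfolding m_def by (fact LeastI_ex[OF ex], fact not_less_Least)
    have "m \<noteq> 0"
    proof
      assume "m = 0"
      with m have "1 \<le> 1 / N" using \<beta>_le by simp
      with N show False by simp
    qed
    then obtain p where p: "m = Suc p" using not0_implies_Suc by blast
    then have gap: "\<beta> ^ p * (\<beta> - 1) \<le> 1" using least[of p] by simp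
    have "5 \<le> n" using 3 by simp
    then obtain \<gamma> :: complex where \<gamma>: "\<gamma> ^ n = \<gamma> + 1" "1 < cmod \<gamma>"
      "2 * cos (pi / (real n - 1)) \<le> cmod \<gamma> ^ n" "2 * sin (pi / real n) \<le> cmod (\<gamma> - 1)"
      by (rule trinomial_root_first_sector)
    have big: "N / 2.72 < cmod \<gamma> ^ m"
      unfolding N_def using conjugate_power_large[OF 3 assms(2,3) m \<gamma>(2,3)] .
    have "5 / N \<le> 2 * sin (pi / N)"
    proof -
      have "pi / N \<le> pi / 6" using N by (intro divide_left_mono) auto
      also have "\<dots> \<le> 0.525" using pi_bounds by simp
      finally have "(pi / N)\<^sup>2 \<le> 0.525\<^sup>2" using N by (intro power_mono) auto
      then have "5 / 6 \<le> cos (pi / N)"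
        using cos_lower_bound[of "pi / N"] by (simp add: power2_eq_square)
      then have "3 / N * (5 / 6) \<le> pi / N * cos (pi / N)"
        using pi_bounds N by (intro mult_mono divide_right_mono) auto
      also have "\<dots> \<le> sin (pi / N)"
        using N by (intro mult_cos_le_sin) (auto simp: field_simps)
      finally show ?thesis by simp
    qed
    then have dist: "5 / N \<le> cmod (\<gamma> - 1)" using \<gamma>(4) by (simp add: N_def)
    have "1 < 5 / N * (N / 2.72 - 1)" using N by (simp add: field_simps)
    also have "\<dots> \<le> cmod (\<gamma> - 1) * (cmod \<gamma> ^ m - 1)"
      using dist big N by (intro mult_mono) auto
    finally show ?thesis
      using that[OF \<gamma>(1,2) gap] by (simp add: p)
  qed
qed

section \<open>Parry numbers among the trinomial roots\<close>

theorem theorem1p1: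
  fixes n :: nat
  assumes "2 \<le> n"
  shows "parry_number (beta_root n) \<longleftrightarrow> n = 2 \<or> n = 3"
proof -
  define \<beta> where "\<beta> = beta_root n"
  have "1 < \<beta> \<and> \<beta> ^ n - \<beta> - 1 = 0"
    unfolding \<beta>_def beta_root_def by (rule theI'[OF ex1_root[OF assms]])
  then have \<beta>: "1 < \<beta>" "\<beta> ^ n = \<beta> + 1" by auto
  have "\<beta> \<le> 2"
  proof (rule ccontr)
    assume "\<not> \<beta> \<le> 2"
    then have "2 * \<beta> < \<beta> * \<beta>" using \<beta>(1) by (intro mult_strict_right_mono) auto
    also have "\<beta> * \<beta> \<le> \<beta> ^ n"
      using \<beta>(1) assms power_increasing[of 2 n \<beta>] by (simp add: power2_eq_square)
    finally show False using \<beta> by simp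
  qed
  show ?thesis
  proof
    assume "n = 2 \<or> n = 3"
    then show "parry_number (beta_root n)"
    proof
      assume "n = 2"
      then have "\<beta> ^ 1 * (\<beta> - 1) = 1"
        using \<beta>(2) by (simp add: power2_eq_square algebra_simps)
      with \<beta>(1) \<open>\<beta> \<le> 2\<close> show ?thesis
        unfolding \<beta>_def by (rule parry_number_if_simple_orbit)
    next
      assume "n = 3"
      then have "\<beta> ^ 3 = \<beta> + 1" using \<beta>(2) by simp
      \<comment> \<open>Here \<open>\<beta> ^ 5 - \<beta> ^ 4 - 1 = (\<beta> ^ 3 - \<beta> - 1) * (\<beta>\<^sup>2 - \<beta> + 1)\<close>.\<close>
      then have "\<beta> ^ 4 * (\<beta> - 1) = 1" by algebra
      with \<beta>(1) \<open>\<beta> \<le> 2\<close> show ?thesis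
        unfolding \<beta>_def by (rule parry_number_if_simple_orbit)
    qed
  next
    assume "parry_number (beta_root n)"
    then have "sofic (beta_shift \<beta>)" by (simp add: parry_number_def \<beta>_def)
    then obtain M N where "M < N"
      and per: "\<And>j. expansion_of_one \<beta> (M + j) = expansion_of_one \<beta> (N + j)"
      using sofic_imp_eventually_periodic[OF \<beta>(1)] by blast
    show "n = 2 \<or> n = 3"
    proof (rule ccontr)
      assume "\<not> (n = 2 \<or> n = 3)"
      then have "4 \<le> n" using assms by linarith
      then obtain \<gamma> :: complex and p where \<gamma>: "\<gamma> ^ n = \<gamma> + 1" "1 < cmod \<gamma>"
        and gap: "\<beta> ^ p * (\<beta> - 1) \<le> 1" and big: "1 < cmod (\<gamma> - 1) * (cmod \<gamma> ^ Suc p - 1)"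
        using trinomial_conjugate_beyond_gap \<beta> by blast
      have "poly (map_poly of_int P) \<gamma> = 0"
        if "poly (map_poly of_int P) \<beta> = 0" for P :: "int poly"
        using irreducible_selmer_poly[of n] \<open>4 \<le> n\<close> that
        by (intro irreducible_common_root_transfer[of "selmer_poly n" \<beta> \<gamma> P])
          (auto simp: poly_selmer_poly \<beta> \<gamma>)
      then have "cmod (\<gamma> - 1) * (cmod \<gamma> ^ Suc p - 1) \<le> 1"
        using \<open>\<beta> \<le> 2\<close> \<open>M < N\<close> \<gamma>(2) by (intro conjugate_gap_bound[OF \<beta>(1) _ gap _ per])
      with big show False by simp
    qed
  qed
qed

end
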